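(* Let $0<\rho<1$, let $\alpha_0=1$, and let $\alpha_1\ge\alpha_2\ge\cdots>0$ be real numbers satisfying $\frac{\alpha_{\ell+1}}{\alpha_\ell}\ge\rho$ for $\ell=1,2,\ldots$. Define $$\eta_{\min}^2=\min\left(1,\frac{\alpha_0}{\alpha_1}\right),\qquad \eta_{\max}^2=\max\left(\frac{\alpha_0}{\alpha_1},\frac1\rho\right).$$ Let $C(\mathrm{SNR})$ be the capacity of the associated noncoherent interference channel $Y_k=H_kX_k+\sum_{\ell=1}^\infty H_{\ell,k}X_{\ell,k}+Z_k$, as defined in the context. Then $$C(\mathrm{SNR})\le\log\frac{\pi}{2}+2\left(\frac{\eta_{\max}^2}{\eta_{\min}^2}-\frac12\right)+\log\eta_{\max}^2+\frac12\log\frac{\eta_{\max}^2}{\eta_{\min}^2},\qquad \mathrm{SNR}>0 .$$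
   Context: Notation: $A_1^n=(A_1,\ldots,A_n)$; $\mathcal N_{\mathbb C}(0,v)$ is the circularly-symmetric complex Gaussian law of mean $0$ and variance $v$; logarithms are natural, so mutual information $I(\cdot;\cdot)$ is in nats. Channel model: for $k\in\mathbb Z$, the complex-valued output is $$Y_k=H_kX_k+\sum_{\ell=1}^{\infty}H_{\ell,k}X_{\ell,k}+Z_k ,$$ where $X_k$ is the input of the transmitter and $X_{\ell,k}$ is the symbol of the $\ell$-th interferer. The sequences $\{Z_k\}_k$, $\{H_k\}_k$ and $\{H_{\ell,k}\}_k$, $\ell=1,2,\ldots$, are each i.i.d. in $k$ and are independent of each other, with $Z_k\sim\mathcal N_{\mathbb C}(0,\sigma^2)$ ($\sigma^2>0$), $H_k\sim\mathcal N_{\mathbb C}(0,1)$ and $H_{\ell,k}\sim\mathcal N_{\mathbb C}(0,\alpha_\ell)$. Thus $\alpha_0=1$ is the variance of $H_{0,k}:=H_k$. The fading and noise are independent of all the symbols $X_k, X_{\ell,k}$. The infinite sum is assumed to converge almost surely, so that $Y_k$ is a well-defined complex random variable. The nodes do not cooperate and use the same distribution: for block length $n$ and a probability distribution $Q^n$ on $\mathbb C^n$, the vectors $X_1^n=(X_1,\ldots,X_n)$ and $X_{\ell,1}^n=(X_{\ell,1},\ldots,X_{\ell,n})$, $\ell=1,2,\ldots$, are independent of each other and each has distribution $Q^n$ (the components within a vector need not be i.i.d.). Capacity: for $\mathsf P>0$ and $\mathrm{SNR}=\mathsf P/\sigma^2$, $$C(\mathrm{SNR})=\limsup_{n\to\infty}\frac1n\sup_{Q^n}I(X_1^n;Y_1^n),$$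 where the supremum is over all probability distributions $Q^n$ on $\mathbb C^n$ satisfying $\int\frac1n\sum_{k=1}^n|x_k|^2\,dQ^n(x_1^n)\le\mathsf P$. Only the transmitter's vector $X_1^n$ appears in the mutual information; the interferers' symbols, fading and noise are unobserved. *)

theory Defs
  imports "HOL-Probability.Probability"
begin

text \<open>Circularly-symmetric complex Gaussian law of mean 0 and variance \<open>v > 0\<close>
  (the variance is \<open>E |Z|^2\<close>, so each real component has variance \<open>v / 2\<close>).\<close>

definition complex_gaussian :: "real \<Rightarrow> complex measure" where
  "complex_gaussian v = density lborel (\<lambda>z. ennreal (exp (- (cmod z)\<^sup>2 / v) / (pi * v)))"

text \<open>Mutual information in nats with values in the extended reals.  The library's
  \<open>mutual_information\<close> is a Bochner integral, hence real-valued; it is the true value exactly when the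
  joint law has a density with respect to the product of the marginals whose logarithm is integrable
  under the joint law.  In all other cases the relative entropy is infinite (for probability
  measures the negative part of its integrand is always integrable).\<close>

definition mutual_information_nats ::
  "'a measure \<Rightarrow> 'b measure \<Rightarrow> 'c measure \<Rightarrow> ('a \<Rightarrow> 'b) \<Rightarrow> ('a \<Rightarrow> 'c) \<Rightarrow> ereal" where
  "mutual_information_nats M S T X Y =
    (let marg = distr M S X \<Otimes>\<^sub>M distr M T Y;
         joint = distr M (S \<Otimes>\<^sub>M T) (\<lambda>\<omega>. (X \<omega>, Y \<omega>))
     in if absolutely_continuous marg joint \<and> integrable joint (entropy_density (exp 1) marg joint)
        then ereal (prob_space.mutual_information M (exp 1) S T X Y) else \<infinity>)"

text \<open>Blocks of length \<open>n\<close> are functions on the time indices \<open>{1..n}\<close>.\<close>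

abbreviation block_space :: "nat \<Rightarrow> (nat \<Rightarrow> complex) measure" where
  "block_space n \<equiv> Pi\<^sub>M {1..n} (\<lambda>_. borel)"

definition admissible_inputs :: "real \<Rightarrow> nat \<Rightarrow> (nat \<Rightarrow> complex) measure set" where
  "admissible_inputs P n =
    {Q. prob_space Q \<and> sets Q = sets (block_space n) \<and>
        (\<integral>\<^sup>+ x. ennreal (1 / real n * (\<Sum>k=1..n. (cmod (x k))\<^sup>2)) \<partial>Q) \<le> ennreal P}"

text \<open>A sample is a triple \<open>(x, h, z)\<close> with independent components: \<open>x l\<close> is the
  block sent by user \<open>l\<close>, \<open>h (l, k)\<close> the fading coefficient of user \<open>l\<close> at
  time \<open>k\<close>, and \<open>z k\<close> the noise at time \<open>k\<close>.  User 0 is the transmitter and users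
  1, 2, ... are the interferers; \<open>Q\<close> is the common law of all the blocks,
  \<open>\<alpha> l\<close> the fading variance of user \<open>l\<close>, and \<open>\<sigma>2\<close> the noise variance.\<close>

type_synonym sample = "(nat \<Rightarrow> nat \<Rightarrow> complex) \<times> (nat \<times> nat \<Rightarrow> complex) \<times> (nat \<Rightarrow> complex)"

definition channel_space ::
  "(nat \<Rightarrow> real) \<Rightarrow> real \<Rightarrow> nat \<Rightarrow> (nat \<Rightarrow> complex) measure \<Rightarrow> sample measure" where
  "channel_space \<alpha> \<sigma>2 n Q =
    Pi\<^sub>M UNIV (\<lambda>_. Q) \<Otimes>\<^sub>M
    (Pi\<^sub>M (UNIV \<times> {1..n}) (\<lambda>(l, k). complex_gaussian (\<alpha> l)) \<Otimes>\<^sub>M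
     Pi\<^sub>M {1..n} (\<lambda>_. complex_gaussian \<sigma>2))"

definition channel_input :: "sample \<Rightarrow> nat \<Rightarrow> complex" where
  "channel_input = (\<lambda>(x, h, z). x 0)"

definition interference_term :: "nat \<Rightarrow> sample \<Rightarrow> nat \<Rightarrow> complex" where
  "interference_term k = (\<lambda>(x, h, z) l. h (Suc l, k) * x (Suc l) k)"

definition channel_output :: "nat \<Rightarrow> sample \<Rightarrow> nat \<Rightarrow> complex" where
  "channel_output n = (\<lambda>(x, h, z). \<lambda>k\<in>{1..n}.
     h (0, k) * x 0 k + (\<Sum>l. interference_term k (x, h, z) l) + z k)"

text \<open>Well-definedness of the outputs: the interference series converges almost surely for every
  input law allowed by the power constraint.\<close>

definition interference_converges :: "(nat \<Rightarrow> real) \<Rightarrow> real \<Rightarrow> real \<Rightarrow> bool" where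
  "interference_converges \<alpha> P \<sigma>2 \<longleftrightarrow>
    (\<forall>n. \<forall>Q \<in> admissible_inputs P n. \<forall>k \<in> {1..n}.
       AE \<omega> in channel_space \<alpha> \<sigma>2 n Q. summable (interference_term k \<omega>))"

definition capacity :: "(nat \<Rightarrow> real) \<Rightarrow> real \<Rightarrow> real \<Rightarrow> ereal" where
  "capacity \<alpha> P \<sigma>2 =
    limsup (\<lambda>n. ereal (1 / real n) *
      (SUP Q \<in> admissible_inputs P n.
         mutual_information_nats (channel_space \<alpha> \<sigma>2 n Q) (block_space n) (block_space n)
           channel_input (channel_output n)))"

end

theory Submission
  imports Defs
begin

text \<open>
  Given all blocks, the outputs are independent complex Gaussians whose variances are the received
  powers \<open>\<Gamma>\<^sub>k = \<sigma>2 + (\<Sum>l. \<alpha> l |x l k|\<^sup>2)\<close>.  Revealing the fading of the transmitter gives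
  \<open>I(X; Y) \<le> h(Y) - h(Y')\<close>, where \<open>Y'\<close> is interference plus noise.  As all users send blocks of the
  same law, \<open>Y'\<close> is again a Gaussian mixture over the same blocks, with variances
  \<open>\<Gamma>'\<^sub>k = \<sigma>2 + (\<Sum>l. \<alpha> (l + 1) |x l k|\<^sup>2)\<close>, and the ratio conditions yield
  \<open>\<Gamma> / M \<le> \<Gamma>' \<le> \<Gamma> / m\<close> with \<open>M = \<eta>max2\<close> and \<open>m = \<eta>min2\<close>.

  By \<open>ln t \<le> t - 1\<close>, the information that \<open>Y'\<close> carries on the blocks is at least what the mismatched
  kernel \<open>\<Prod>k. exp (- M |y\<^sub>k|\<^sup>2 / \<Gamma>\<^sub>k) / (\<pi> \<Gamma>\<^sub>k)\<close> achieves.  Averaged over the blocks, this kernel is the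
  density of \<open>Y\<close> at \<open>sqrt M y\<close>, and coupling the two mixtures through a common Gaussian vector makes
  \<open>sqrt M |Y'| \<ge> |Y|\<close>, where the density of \<open>Y\<close> is smaller.  This bounds the information per symbol by
  \<open>ln M + M / m - 1\<close>, which is below the claimed value.

  To avoid differential entropies, both steps are merged into a single application of \<open>ln t \<le> t - 1\<close>.
\<close>

section \<open>Complex Gaussian densities\<close>

text \<open>The blocks may be arbitrarily dependent in time, so both outputs are mixtures without an
  entropy formula; the comparison is made on kernels that belong to the same block sequence. The
  factor M sits in the exponent only, so that the mismatched kernel is the Gaussian density with
  variances \<open>\<Gamma>\<^sub>k\<close> at sqrt M y and averages exactly to the density f of Y
  at that point, whatever the input law is. Write p for the density of Y given the sent block, B for
  the true kernel of Y' and A for the mismatched one. The merged step reads ln p <= t - 1 + ln (B /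
  A) + ln f(sqrt M Y'), where t = p A / (B f) has mean 1. If Y' is sqrt \<Gamma>' times a standard
  Gaussian g, each symbol contributes ln (\<Gamma> / \<Gamma>') + (M \<Gamma>' / \<Gamma> - 1) |g|^2
  to ln (B / A). The first summand is at most ln M, the second has mean at most M / m - 1. The term
  ln f(sqrt M Y') is at most ln f(Y), whose mean is what the mutual information subtracts.
  Integrability is then required only of ln p and ln f under the channel law, and it follows from
  the finite energy of the symbols.\<close>

definition cgauss_density :: "real \<Rightarrow> complex \<Rightarrow> real" where
  "cgauss_density v y = exp (- (cmod y)\<^sup>2 / v) / (pi * v)"

lemma complex_gaussian_eq: "complex_gaussian v = density lborel (\<lambda>z. ennreal (cgauss_density v z))"
  unfolding complex_gaussian_def cgauss_density_def ..

lemma cgauss_density_pos: "v > 0 \<Longrightarrow> cgauss_density v y > 0"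
  unfolding cgauss_density_def by simp

lemma cgauss_density_nonneg: "v > 0 \<Longrightarrow> 0 \<le> cgauss_density v y"
  using cgauss_density_pos[of v y] by simp

lemma measurable_cgauss_density[measurable]:
  assumes [measurable]: "f \<in> borel_measurable M" "g \<in> borel_measurable M"
  shows "(\<lambda>x. cgauss_density (f x) (g x)) \<in> borel_measurable M"
  unfolding cgauss_density_def by measurable

lemma nn_integral_complex_prod:
  fixes f g :: "real \<Rightarrow> ennreal"
  assumes [measurable]: "f \<in> borel_measurable borel" "g \<in> borel_measurable borel"
  shows "(\<integral>\<^sup>+ z. f (Re z) * g (Im z) \<partial>lborel) = (\<integral>\<^sup>+ x. f x \<partial>lborel) * (\<integral>\<^sup>+ x. g x \<partial>lborel)"
proof -
  define F where "F b = (if b = (1::complex) then f else g)" for b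
  have "(\<integral>\<^sup>+ z. (\<Prod>b\<in>Basis. F b (z \<bullet> b)) \<partial>(lborel :: complex measure)) = (\<Prod>b\<in>Basis. \<integral>\<^sup>+ x. F b x \<partial>lborel)"
    by (rule nn_integral_lborel_prod) (auto simp: F_def)
  moreover have "(\<Prod>b\<in>Basis. F b (z \<bullet> b)) = f (Re z) * g (Im z)" for z
    by (simp add: Basis_complex_def F_def)
  ultimately show ?thesis
    by (simp add: Basis_complex_def F_def)
qed

lemma nn_integral_normal_density:
  assumes "s > 0"
  shows "(\<integral>\<^sup>+ x. ennreal (normal_density m s x) \<partial>lborel) = 1"
  using assms nn_integral_eq_integral[OF integrable_normal_density[OF assms, of m]]
  by (simp add: normal_density_nonneg integral_normal_density)

lemma nn_integral_normal_second_moment: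
  assumes "s > 0"
  shows "(\<integral>\<^sup>+ x. ennreal (normal_density 0 s x * x\<^sup>2) \<partial>lborel) = ennreal (s\<^sup>2)"
proof -
  from normal_moment_even[OF assms, of 0 1]
  have "has_bochner_integral lborel (\<lambda>x. normal_density 0 s x * x\<^sup>2) (s\<^sup>2)"
    by (simp add: power2_eq_square)
  then show ?thesis
    by (intro nn_integral_eq_integral[THEN trans])
      (auto simp: has_bochner_integral_iff normal_density_nonneg)
qed

lemma cgauss_density_eq_normal:
  assumes "v > 0"
  shows "cgauss_density v z = normal_density 0 (sqrt (v / 2)) (Re z) * normal_density 0
      (sqrt (v / 2)) (Im z)"
proof -
  have "exp (- (cmod z)\<^sup>2 / v) = exp (- (Re z)\<^sup>2 / v) * exp (- (Im z)\<^sup>2 / v)"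
    by (simp add: cmod_power2 mult_exp_exp diff_divide_distrib)
  then show ?thesis
    using assms by (simp add: cgauss_density_def normal_density_def real_sqrt_mult[symmetric])
qed

lemma nn_integral_cgauss_density:
  assumes "v > 0"
  shows "(\<integral>\<^sup>+ z. ennreal (cgauss_density v z) \<partial>lborel) = 1"
proof -
  have "(\<integral>\<^sup>+ z. ennreal (cgauss_density v z) \<partial>lborel)
      = (\<integral>\<^sup>+ z. ennreal (normal_density 0 (sqrt (v / 2)) (Re z)) * ennreal
      (normal_density 0 (sqrt (v / 2)) (Im z)) \<partial>lborel)"
    using assms by (simp add: cgauss_density_eq_normal ennreal_mult normal_density_nonneg)
  also have "\<dots> = 1"
    using assms by (subst nn_integral_complex_prod) (auto simp: nn_integral_normal_density)
  finally show ?thesis .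
qed

lemma prob_space_complex_gaussian: "v > 0 \<Longrightarrow> prob_space (complex_gaussian v)"
  by (rule prob_spaceI) (simp add: complex_gaussian_eq emeasure_density nn_integral_cgauss_density)

lemma sets_complex_gaussian[simp, measurable_cong]: "sets (complex_gaussian v) = sets borel"
  by (simp add: complex_gaussian_eq)

lemma nn_integral_complex_gaussian:
  assumes [measurable]: "f \<in> borel_measurable borel"
  shows "(\<integral>\<^sup>+ z. f z \<partial>complex_gaussian v) = (\<integral>\<^sup>+ z. ennreal (cgauss_density v z) * f z \<partial>lborel)"
  unfolding complex_gaussian_eq by (rule nn_integral_density) auto

lemma complex_gaussian_second_moment:
  assumes "v > 0"
  shows "(\<integral>\<^sup>+ z. ennreal ((cmod z)\<^sup>2) \<partial>complex_gaussian v) = ennreal v"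
proof -
  let ?n = "normal_density 0 (sqrt (v / 2))"
  have "(\<integral>\<^sup>+ z. ennreal ((cmod z)\<^sup>2) \<partial>complex_gaussian v) =
    (\<integral>\<^sup>+ z. (ennreal (?n (Re z) * (Re z)\<^sup>2) * ennreal (?n (Im z)) + ennreal (?n (Re z)) * ennreal
        (?n (Im z) * (Im z)\<^sup>2)) \<partial>lborel)"
    using assms
    by (auto simp: nn_integral_complex_gaussian cgauss_density_eq_normal cmod_power2
        normal_density_nonneg
      ennreal_mult[symmetric] algebra_simps simp flip: ennreal_plus intro!: nn_integral_cong)
  also have "\<dots> = ennreal (v / 2) + ennreal (v / 2)"
    using assms
    by (subst nn_integral_add, simp, simp)
        (subst nn_integral_complex_prod, simp, simp, subst nn_integral_complex_prod, simp, simp,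
      simp add: nn_integral_normal_density nn_integral_normal_second_moment)
  also have "\<dots> = ennreal v"
    using assms by (simp flip: ennreal_plus)
  finally show ?thesis .
qed

lemma nn_integral_lborel_shift:
  fixes f :: "complex \<Rightarrow> ennreal"
  assumes [measurable]: "f \<in> borel_measurable borel"
  shows "(\<integral>\<^sup>+ z. f (c + z) \<partial>lborel) = (\<integral>\<^sup>+ z. f z \<partial>lborel)"
  by (subst (2) lborel_distr_plus[of c, symmetric], subst nn_integral_distr) auto

text \<open>Completing the square in \<open>u\<close>, whence no rotation invariance of \<open>lborel\<close> is needed.\<close>

lemma cgauss_density_complete_square:
  fixes x y u :: complex
  assumes "a > 0" "v > 0"
  defines "w \<equiv> v + a * (cmod x)\<^sup>2"
  shows "cgauss_density a u * cgauss_density v (y - u * x) =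
    cgauss_density w y * cgauss_density (a * v / w) (- (of_real (a / w) * cnj x * y) + u)"
proof -
  have w: "w > 0" using assms by (auto simp: add_pos_nonneg)
  \<comment> \<open>For u of variance \<open>a\<close> observed through y = u x + noise of variance
    \<open>v\<close>, the subtracted term is the conditional mean of u given y and
    \<open>a * v / w\<close> the conditional variance: prior times likelihood becomes marginal times
    posterior.\<close>
  define t where "t = - (of_real (a / w) * cnj x * y) + u"
  have "(cmod u)\<^sup>2 / a + (cmod (y - u * x))\<^sup>2 / v =
    (cmod y)\<^sup>2 / w + (cmod t)\<^sup>2 / (a * v / w)"
  proof -
    define X where "X = Re x" define X' where "X' = Im x"
    define Y where "Y = Re y" define Y' where "Y' = Im y"
    define U where "U = Re u" define U' where "U' = Im u"
    have w_eq: "w = v + a * (X\<^sup>2 + X'\<^sup>2)" by (simp add: w_def cmod_power2 X_def X'_def)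
    \<comment> \<open>The factor clears all denominators, which leaves a polynomial identity in the
      six real coordinates.\<close>
    have "w * v * a * w * ((cmod u)\<^sup>2 / a + (cmod (y - u * x))\<^sup>2 / v) = w * v * w * (U\<^sup>2 + U'\<^sup>2) + w
        * a * w * ((Y - (U * X - U' * X'))\<^sup>2 + (Y' - (U * X' + U' * X))\<^sup>2)"
      using assms w by (simp add: cmod_power2 field_simps X_def X'_def Y_def Y'_def U_def U'_def)
    also have "\<dots> = v * a * w * (Y\<^sup>2 + Y'\<^sup>2) + w
        * ((w * U - a * (X * Y + X' * Y'))\<^sup>2 + (w * U' - a * (X * Y' - X' * Y))\<^sup>2)"
      unfolding w_eq by algebra
    also have "\<dots> = w * v * a * w * ((cmod y)\<^sup>2 / w + (cmod t)\<^sup>2 / (a * v / w))"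
    proof -
      have "Re t = (w * U - a * (X * Y + X' * Y')) / w" "Im t = (w * U' - a * (X * Y' - X' * Y)) / w"
        using w by (simp_all add: t_def field_simps X_def X'_def Y_def Y'_def U_def U'_def)
      then have t2: "(cmod t)\<^sup>2 * w\<^sup>2 = (w * U - a * (X * Y + X' * Y'))\<^sup>2
          + (w * U' - a * (X * Y' - X' * Y))\<^sup>2"
        unfolding cmod_power2 using w by (simp add: power_divide add_divide_distrib[symmetric])
      have "w * v * a * w * ((cmod y)\<^sup>2 / w + (cmod t)\<^sup>2 / (a * v / w)) =
          v * a * w * (cmod y)\<^sup>2 + w * ((cmod t)\<^sup>2 * w\<^sup>2)"
        using assms(1,2) w by (simp add: field_simps power2_eq_square)
      then show ?thesis
        unfolding t2 by (simp add: Y_def Y'_def cmod_power2)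
    qed
    finally show ?thesis using assms(1,2) w by simp
  qed
  then have "exp (- ((cmod u)\<^sup>2 / a)) * exp (- ((cmod (y - u * x))\<^sup>2 / v)) =
    exp (- ((cmod y)\<^sup>2 / w)) * exp (- ((cmod t)\<^sup>2 / (a * v / w)))"
    by (simp add: mult_exp_exp minus_add_distrib[symmetric] del: minus_add_distrib)
  then show ?thesis
    using assms(1,2) w unfolding cgauss_density_def t_def[symmetric] by (simp add: field_simps)
qed

text \<open>Completing the square leaves a posterior density in \<open>u\<close>, which integrates
  to 1 by translation invariance. So integrating out one fading coefficient only raises the noise
  variance by the faded power of its symbol.\<close>

lemma nn_integral_cgauss_convolution:
  assumes "a > 0" "v > 0"
  shows "(\<integral>\<^sup>+ u. ennreal (cgauss_density v (y - u * x)) \<partial>complex_gaussian a) =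
    ennreal (cgauss_density (v + a * (cmod x)\<^sup>2) y)"
proof -
  define w where "w = v + a * (cmod x)\<^sup>2"
  have w: "w > 0" using assms by (auto simp: w_def add_pos_nonneg)
  have "(\<integral>\<^sup>+ u. ennreal (cgauss_density v (y - u * x)) \<partial>complex_gaussian a) =
    (\<integral>\<^sup>+ u. ennreal (cgauss_density a u * cgauss_density v (y - u * x)) \<partial>lborel)"
    using assms by (simp add: nn_integral_complex_gaussian ennreal_mult cgauss_density_nonneg)
  also have "\<dots> = (\<integral>\<^sup>+ u. ennreal (cgauss_density w y) * ennreal
      (cgauss_density (a * v / w) (- (of_real (a / w) * cnj x * y) + u)) \<partial>lborel)"
    unfolding cgauss_density_complete_square[OF assms] w_def[symmetric]
    using assms w by (simp add: ennreal_mult cgauss_density_nonneg)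
  also have "\<dots> = ennreal (cgauss_density w y)"
    using assms w
    by (subst nn_integral_cmult, simp,
        subst nn_integral_lborel_shift[where f="\<lambda>u. ennreal (cgauss_density (a * v / w) u)"])
      (simp_all add: nn_integral_cgauss_density)
  finally show ?thesis unfolding w_def .
qed

lemma nn_integral_cgauss_scale:
  assumes [measurable]: "f \<in> borel_measurable borel" and "c > 0"
  shows "(\<integral>\<^sup>+ z. f (of_real c * z) \<partial>complex_gaussian 1) = (\<integral>\<^sup>+ z. f z \<partial>complex_gaussian (c\<^sup>2))"
proof -
  have "(\<integral>\<^sup>+ z. f z \<partial>complex_gaussian (c\<^sup>2)) = (\<integral>\<^sup>+ z. ennreal (cgauss_density (c\<^sup>2) z) * f z \<partial>lborel)"
    by (simp add: nn_integral_complex_gaussian)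
  \<comment> \<open>The Jacobian is the square of \<open>c\<close> because the plane has real
    dimension 2.\<close>
  also have "\<dots> = (\<integral>\<^sup>+ z. ennreal (c\<^sup>2) * (ennreal (cgauss_density (c\<^sup>2) (of_real c * z))
      * f (of_real c * z)) \<partial>lborel)"
    using assms(2)
    by (subst lborel_affine[of c 0])
      (auto simp: nn_integral_density nn_integral_distr scaleR_conv_of_real ennreal_power)
  also have "\<dots> = (\<integral>\<^sup>+ z. ennreal (cgauss_density 1 z) * f (of_real c * z) \<partial>lborel)"
    using assms(2) by (intro nn_integral_cong)
      (simp add: mult.assoc[symmetric] ennreal_mult[symmetric] cgauss_density_nonneg
       cgauss_density_def norm_mult power_mult_distrib)
  also have "\<dots> = (\<integral>\<^sup>+ z. f (of_real c * z) \<partial>complex_gaussian 1)"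
    by (simp add: nn_integral_complex_gaussian)
  finally show ?thesis ..
qed

section \<open>Finite products and random series\<close>

text \<open>Both sides agree on boxes, where the integral of a product of one-coordinate functions
  factors. \<open>Mf\<close> is a hypothesis of its own because a density with infinite values can
  destroy sigma-finiteness.\<close>

lemma PiM_density_finite:
  assumes "finite K" and M: "product_sigma_finite M"
      and Mf: "product_sigma_finite (\<lambda>k. density (M k) (f k))"
    and [measurable]: "\<And>k. f k \<in> borel_measurable (M k)"
  shows "PiM K (\<lambda>k. density (M k) (f k)) = density (PiM K M) (\<lambda>y. \<Prod>k\<in>K. f k (y k))"
proof -
  interpret M: product_sigma_finite M by fact
  interpret D: product_sigma_finite "\<lambda>k. density (M k) (f k)" by fact
  have [measurable]: "(\<lambda>y. \<Prod>k\<in>K. f k (y k)) \<in> borel_measurable (PiM K M)"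
    by (intro borel_measurable_prod_ennreal) measurable
  show ?thesis
  proof (rule D.PiM_eqI[symmetric])
    show "sets (density (PiM K M) (\<lambda>y. \<Prod>k\<in>K. f k (y k))) = sets (PiM K (\<lambda>k. density (M k) (f k)))"
      by (auto intro!: sets_PiM_cong)
    fix A assume A: "\<And>k. k \<in> K \<Longrightarrow> A k \<in> sets (density (M k) (f k))"
    then have [measurable]: "k \<in> K \<Longrightarrow> A k \<in> sets (M k)" for k by simp
    have "emeasure (density (PiM K M) (\<lambda>y. \<Prod>k\<in>K. f k (y k))) (Pi\<^sub>E K A) =
        (\<integral>\<^sup>+ y. (\<Prod>k\<in>K. f k (y k)) * indicator (Pi\<^sub>E K A) y \<partial>PiM K M)"
      using assms by (intro emeasure_density sets_PiM_I_finite) auto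
    also have "\<dots> = (\<integral>\<^sup>+ y. (\<Prod>k\<in>K. f k (y k) * indicator (A k) (y k)) \<partial>PiM K M)"
      using \<open>finite K\<close>
      by (intro nn_integral_cong)
        (auto simp: prod.distrib indicator_def space_PiM PiE_iff Pi_iff intro!: prod.cong
            split: if_splits)
    also have "\<dots> = (\<Prod>k\<in>K. emeasure (density (M k) (f k)) (A k))"
      using \<open>finite K\<close>
      by (subst M.product_nn_integral_prod) (auto intro!: prod.cong simp: emeasure_density)
    finally show "emeasure (density (PiM K M) (\<lambda>y. \<Prod>k\<in>K. f k (y k))) (Pi\<^sub>E K A) =
        (\<Prod>k\<in>K. emeasure (density (M k) (f k)) (A k))" .
  qed fact
qed

lemma PiM_distr_finite:
  assumes "finite K" and M: "product_sigma_finite M"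
      and Mf: "product_sigma_finite (\<lambda>k. distr (M k) (N k) (f k))"
    and [measurable]: "\<And>k. f k \<in> measurable (M k) (N k)"
  shows "PiM K (\<lambda>k. distr (M k) (N k) (f k)) = distr (PiM K M) (PiM K N) (\<lambda>y. \<lambda>k\<in>K. f k (y k))"
proof -
  interpret M: product_sigma_finite M by fact
  interpret D: product_sigma_finite "\<lambda>k. distr (M k) (N k) (f k)" by fact
  show ?thesis
  proof (rule D.PiM_eqI[symmetric])
    show "sets (distr (PiM K M) (PiM K N) (\<lambda>y. \<lambda>k\<in>K. f k (y k)))
        = sets (PiM K (\<lambda>k. distr (M k) (N k) (f k)))"
      by (auto intro!: sets_PiM_cong)
    fix A assume A: "\<And>k. k \<in> K \<Longrightarrow> A k \<in> sets (distr (M k) (N k) (f k))"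
    then have [measurable]: "k \<in> K \<Longrightarrow> A k \<in> sets (N k)" for k by simp
    have "emeasure (distr (PiM K M) (PiM K N) (\<lambda>y. \<lambda>k\<in>K. f k (y k))) (Pi\<^sub>E K A) =
        (\<integral>\<^sup>+ y. indicator (Pi\<^sub>E K A) y \<partial>distr (PiM K M) (PiM K N) (\<lambda>y. \<lambda>k\<in>K. f k (y k)))"
      using \<open>finite K\<close> by (intro nn_integral_indicator[symmetric]) (auto intro!: sets_PiM_I_finite)
    also have "\<dots> = (\<integral>\<^sup>+ y. indicator (Pi\<^sub>E K A) (\<lambda>k\<in>K. f k (y k)) \<partial>PiM K M)"
      using \<open>finite K\<close> by (intro nn_integral_distr)
          (auto intro!: borel_measurable_indicator sets_PiM_I_finite)
    also have "\<dots> = (\<integral>\<^sup>+ y. (\<Prod>k\<in>K. indicator (A k) (f k (y k))) \<partial>PiM K M)"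
      using \<open>finite K\<close>
      by (intro nn_integral_cong) (auto simp: indicator_def PiE_iff)
    also have "\<dots> = (\<Prod>k\<in>K. emeasure (distr (M k) (N k) (f k)) (A k))"
      using \<open>finite K\<close>
      by (subst M.product_nn_integral_prod)
        (auto intro!: prod.cong simp: nn_integral_indicator[symmetric] nn_integral_distr
            simp del: nn_integral_indicator)
    finally show "emeasure (distr (PiM K M) (PiM K N) (\<lambda>y. \<lambda>k\<in>K. f k (y k))) (Pi\<^sub>E K A) =
        (\<Prod>k\<in>K. emeasure (distr (M k) (N k) (f k)) (A k))" .
  qed fact
qed

text \<open>Independence means that the joint law is the product of the marginals. Restriction to
  \<open>I\<close> moves no point of the product space, so the joint law is the product measure
  itself, for infinite \<open>I\<close> as well.\<close>

lemma indep_vars_PiM_coordinates: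
  assumes M: "\<And>i. i \<in> I \<Longrightarrow> prob_space (M i)" and "I \<noteq> {}"
  shows "prob_space.indep_vars (PiM I M) M (\<lambda>i \<omega>. \<omega> i) I"
proof -
  interpret prob_space "PiM I M" by (rule prob_space_PiM) fact
  have "distr (PiM I M) (PiM I M) (\<lambda>x. \<lambda>i\<in>I. x i) = distr (PiM I M) (PiM I M) (\<lambda>x. x)"
    by (intro distr_cong) (auto simp: space_PiM)
  also have "\<dots> = PiM I M" by simp
  also have "\<dots> = PiM I (\<lambda>i. distr (PiM I M) (M i) (\<lambda>\<omega>. \<omega> i))"
    by (intro PiM_cong distr_PiM_component[symmetric] M) auto
  finally show ?thesis
    using \<open>I \<noteq> {}\<close> by (subst indep_vars_iff_distr_eq_PiM') auto
qed

lemma measurable_PiM_column: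
  assumes "UNIV \<times> {k} \<subseteq> I"
  shows "(\<lambda>h l. h (l, k)) \<in> measurable (PiM I (\<lambda>(l, k). C l)) (PiM UNIV C)"
proof (rule measurable_PiM_single')
  fix l show "(\<lambda>h. h (l, k)) \<in> measurable (PiM I (\<lambda>(l, k). C l)) (C l)"
    using measurable_component_singleton[of "(l, k)" I "\<lambda>(l, k). C l"] assms by auto
qed (use assms in \<open>fastforce simp: space_PiM PiE_iff\<close>)

lemma distr_PiM_column:
  assumes "\<And>l. prob_space (C l)" "k \<in> K"
  shows "distr (PiM (UNIV \<times> K) (\<lambda>(l, k). C l)) (PiM UNIV C) (\<lambda>h l. h (l, k)) = PiM UNIV C"
  using distr_PiM_reindex[of "UNIV \<times> K" "\<lambda>(l, k). C l" "\<lambda>l. (l, k)" UNIV] assms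
  by (auto simp: inj_on_def restrict_UNIV)

text \<open>The fading array has infinitely many users, so Fubini for finite products cannot split
  it by time. Its columns are independent instead, being disjoint groups of independent coordinates,
  and each column is distributed like the product over the users.\<close>

lemma nn_integral_PiM_columns:
  fixes C :: "'l \<Rightarrow> 'b measure"
  assumes "finite K" and C: "\<And>l. prob_space (C l)"
    and f[measurable]: "\<And>k. k \<in> K \<Longrightarrow> f k \<in> borel_measurable (PiM UNIV C)"
  shows "(\<integral>\<^sup>+ h. (\<Prod>k\<in>K. f k (\<lambda>l. h (l, k))) \<partial>PiM (UNIV \<times> K) (\<lambda>(l, k). C l)) =
    (\<Prod>k\<in>K. \<integral>\<^sup>+ g. f k g \<partial>PiM UNIV C)"
proof (cases "K = {}")
  case True
  then show ?thesis by (simp add: space_PiM)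
next
  case False
  let ?C = "\<lambda>(l :: 'l, k :: 'c). C l"
  have C': "prob_space (?C i)" for i using C by (cases i) auto
  interpret prob_space "PiM (UNIV \<times> K) ?C" by (rule prob_space_PiM) (rule C')
  note col[measurable] = measurable_PiM_column[of _ _ C]
  have "indep_vars (\<lambda>k. PiM (UNIV \<times> {k}) ?C) (\<lambda>k \<omega>. restrict (\<lambda>i. \<omega> i) (UNIV \<times> {k})) K"
    using False by (intro indep_vars_restrict[OF indep_vars_PiM_coordinates[OF C']])
      (auto simp: disjoint_family_on_def)
  then have "indep_vars (\<lambda>_. borel) (\<lambda>k \<omega>. f k (\<lambda>l. restrict (\<lambda>i. \<omega> i) (UNIV \<times> {k}) (l, k))) K"
    by (rule indep_vars_compose2[where Y = "\<lambda>k h. f k (\<lambda>l. h (l, k))"])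
      (rule measurable_compose[OF col f], auto)
  then have "indep_vars (\<lambda>_. borel) (\<lambda>k \<omega>. f k (\<lambda>l. \<omega> (l, k))) K"
    by simp
  then have "(\<integral>\<^sup>+ h. (\<Prod>k\<in>K. f k (\<lambda>l. h (l, k))) \<partial>PiM (UNIV \<times> K) ?C) =
      (\<Prod>k\<in>K. \<integral>\<^sup>+ h. f k (\<lambda>l. h (l, k)) \<partial>PiM (UNIV \<times> K) ?C)"
    using \<open>finite K\<close> by (intro indep_vars_nn_integral) auto
  also have "\<dots> = (\<Prod>k\<in>K. \<integral>\<^sup>+ g. f k g \<partial>PiM UNIV C)"
  proof (rule prod.cong[OF refl])
    fix k assume k: "k \<in> K"
    have "(\<integral>\<^sup>+ g. f k g \<partial>PiM UNIV C) = (\<integral>\<^sup>+ g. f k g \<partial>distr (PiM (UNIV \<times> K) ?C) (PiM UNIV C)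
        (\<lambda>\<omega> l. \<omega> (l, k)))"
      using distr_PiM_column[of C k K] C k by simp
    also have "\<dots> = (\<integral>\<^sup>+ h. f k (\<lambda>l. h (l, k)) \<partial>PiM (UNIV \<times> K) ?C)"
      using k by (intro nn_integral_distr col f) auto
    finally show "(\<integral>\<^sup>+ h. f k (\<lambda>l. h (l, k)) \<partial>PiM (UNIV \<times> K) ?C) = (\<integral>\<^sup>+ g. f k g \<partial>PiM UNIV C)" ..
  qed
  finally show ?thesis .
qed

text \<open>The users are absorbed one at a time: with the coefficient of user \<open>N\<close> held
  fixed, its contribution is a shift of \<open>y\<close>, which is why the induction keeps
  \<open>y\<close> arbitrary.\<close>

lemma nn_integral_cgauss_partial_sum:
  fixes \<alpha> :: "nat \<Rightarrow> real"
  assumes \<alpha>: "\<And>l. \<alpha> l > 0" and v: "v > 0"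
  shows "(\<integral>\<^sup>+ h. ennreal (cgauss_density v (y - (\<Sum>l<N. h l * x l))) \<partial>PiM UNIV
      (\<lambda>l. complex_gaussian (\<alpha> l))) =
    ennreal (cgauss_density (v + (\<Sum>l<N. \<alpha> l * (cmod (x l))\<^sup>2)) y)"
proof -
  let ?C = "\<lambda>l. complex_gaussian (\<alpha> l)"
  interpret product_prob_space ?C UNIV
    by (intro product_prob_spaceI prob_space_complex_gaussian \<alpha>)
  have fin: "(\<integral>\<^sup>+ h. ennreal (cgauss_density v (y - (\<Sum>l<N. h l * x l))) \<partial>PiM {..<N} ?C) =
    ennreal (cgauss_density (v + (\<Sum>l<N. \<alpha> l * (cmod (x l))\<^sup>2)) y)"
  proof (induction N arbitrary: y)
    case 0
    then show ?case by (simp add: PiM_empty)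
  next
    case (Suc N)
    let ?v = "v + (\<Sum>l<N. \<alpha> l * (cmod (x l))\<^sup>2)"
    have "?v > 0" using v \<alpha> by (intro add_pos_nonneg sum_nonneg) (auto simp: less_imp_le)
    have "(\<integral>\<^sup>+ h. ennreal (cgauss_density v (y - (\<Sum>l<Suc N. h l * x l))) \<partial>PiM {..<Suc N} ?C) =
      (\<integral>\<^sup>+ u. \<integral>\<^sup>+ h. ennreal (cgauss_density v (y - (\<Sum>l<Suc N. (h(N := u)) l * x l))) \<partial>PiM {..<N} ?C
          \<partial>?C N)"
      unfolding lessThan_Suc by (subst product_nn_integral_insert_rev) auto
    also have "\<dots> = (\<integral>\<^sup>+ u. \<integral>\<^sup>+ h. ennreal (cgauss_density v ((y - u * x N) - (\<Sum>l<N. h l * x l)))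
        \<partial>PiM {..<N} ?C \<partial>?C N)"
      by (intro nn_integral_cong arg_cong[where f=ennreal] arg_cong2[where f=cgauss_density])
        (auto simp: algebra_simps)
    also have "\<dots> = ennreal (cgauss_density (?v + \<alpha> N * (cmod (x N))\<^sup>2) y)"
      unfolding Suc using \<alpha> \<open>?v > 0\<close> by (rule nn_integral_cgauss_convolution)
    finally show ?case by (simp add: algebra_simps)
  qed
  \<comment> \<open>The partial sum depends on finitely many coordinates, so the infinite product
    may be replaced by its marginal on them.\<close>
  have "(\<integral>\<^sup>+ h. ennreal (cgauss_density v (y - (\<Sum>l<N. h l * x l))) \<partial>PiM {..<N} ?C) =
     (\<integral>\<^sup>+ h. ennreal (cgauss_density v (y - (\<Sum>l<N. h l * x l))) \<partial>distr (PiM UNIV ?C) (PiM {..<N} ?C)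
         (\<lambda>h. restrict h {..<N}))"
    by (subst distr_PiM_restrict_finite) auto
  also have "\<dots> = (\<integral>\<^sup>+ h. ennreal (cgauss_density v (y - (\<Sum>l<N. h l * x l))) \<partial>PiM UNIV ?C)"
    by (subst nn_integral_distr) auto
  finally show ?thesis using fin by simp
qed

text \<open>Summability comes for free: the densities of the partial sums at 0 tend to a positive limit,
  so their variances stay bounded.\<close>

lemma nn_integral_cgauss_infinite_sum:
  fixes \<alpha> :: "nat \<Rightarrow> real"
  assumes \<alpha>: "\<And>l. \<alpha> l > 0" and v: "v > 0"
    and S[measurable]: "S \<in> borel_measurable (PiM UNIV (\<lambda>l. complex_gaussian (\<alpha> l)))"
    and conv: "AE h in PiM UNIV (\<lambda>l. complex_gaussian (\<alpha> l)). (\<lambda>N. \<Sum>l<N. h l * x l) \<longlonglongrightarrow> S h"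
  shows "summable (\<lambda>l. \<alpha> l * (cmod (x l))\<^sup>2)" (is ?summable)
    and "(\<integral>\<^sup>+ h. ennreal (cgauss_density v (y - S h)) \<partial>PiM UNIV (\<lambda>l. complex_gaussian (\<alpha> l))) =
      ennreal (cgauss_density (v + (\<Sum>l. \<alpha> l * (cmod (x l))\<^sup>2)) y)" (is ?eq)
proof -
  let ?C = "\<lambda>l. complex_gaussian (\<alpha> l)"
  interpret product_prob_space ?C UNIV
    by (intro product_prob_spaceI prob_space_complex_gaussian \<alpha>)
  define V where "V N = (\<Sum>l<N. \<alpha> l * (cmod (x l))\<^sup>2)" for N
  have V0: "V N \<ge> 0" for N unfolding V_def using \<alpha> by (auto intro!: sum_nonneg simp: less_imp_le)
  have Vmono: "V N \<le> V (Suc N)" for N unfolding V_def using \<alpha> by (auto simp: less_imp_le)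
  have bound: "cgauss_density v w \<le> 1 / (pi * v)" for w
    using v unfolding cgauss_density_def by (auto simp: divide_right_mono)
  have cont: "((\<lambda>w. cgauss_density v w) \<longlongrightarrow> cgauss_density v w) (at w)" for w
    using v unfolding cgauss_density_def by (intro tendsto_intros) auto
  \<comment> \<open>The noise of variance \<open>v\<close> smooths the partial sums: all integrands
    are bounded by the peak 1 / (pi v), so almost sure convergence of the sums carries over to the
    integrals.\<close>
  have lim: "(\<lambda>N. ennreal (cgauss_density (v + V N) y))
      \<longlonglongrightarrow> (\<integral>\<^sup>+ h. ennreal (cgauss_density v (y - S h)) \<partial>PiM UNIV ?C)" for y
    unfolding V_def nn_integral_cgauss_partial_sum[OF \<alpha> v, symmetric]
  proof (rule nn_integral_dominated_convergence)
    show "(\<integral>\<^sup>+ h. ennreal (1 / (pi * v)) \<partial>PiM UNIV ?C) < \<infinity>"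
      using emeasure_space_1 by simp
    show "AE h in PiM UNIV ?C. (\<lambda>N. ennreal (cgauss_density v (y - (\<Sum>l<N. h l * x l)))) \<longlonglongrightarrow> ennreal
        (cgauss_density v (y - S h))"
      using conv
    proof eventually_elim
      case (elim h)
      have "isCont (cgauss_density v) (y - S h)" using cont by (simp add: isCont_def)
      then show ?case
        by (intro tendsto_ennrealI isCont_tendsto_compose[where g = "cgauss_density v"]
            tendsto_intros elim)
    qed
  qed (use bound in \<open>auto intro!: AE_I2 ennreal_leI\<close>)
  \<comment> \<open>If this limit were 0, a strictly positive integrand would vanish almost surely.
    Since the density at 0 is 1 / (pi (v + V N)), a positive lower bound on it is an upper bound on
    \<open>V N\<close>.\<close>
  let ?c = "\<integral>\<^sup>+ h. ennreal (cgauss_density v (0 - S h)) \<partial>PiM UNIV ?C"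
  have "?c \<noteq> 0"
  proof
    assume "?c = 0"
    then have "AE h in PiM UNIV ?C. ennreal (cgauss_density v (0 - S h)) = 0"
      by (subst (asm) nn_integral_0_iff_AE) auto
    then have "AE h in PiM UNIV ?C. False"
      by eventually_elim (use cgauss_density_pos[OF v] in \<open>auto simp: ennreal_eq_0_iff
          not_le[symmetric]\<close>)
    then show False by simp
  qed
  have "decseq (\<lambda>N. ennreal (cgauss_density (v + V N) 0))"
    unfolding cgauss_density_def decseq_Suc_iff using V0 Vmono v
    by (auto intro!: ennreal_leI divide_left_mono mult_pos_pos add_pos_nonneg)
  from decseq_ge[OF this lim[of 0]] have c: "?c \<le> ennreal (cgauss_density (v + V N) 0)" for N .
  then have "?c < \<top>" using ennreal_less_top order_le_less_trans by blast
  then obtain c where c_def: "?c = ennreal c" "c \<ge> 0" by (cases "?c") auto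
  with \<open>?c \<noteq> 0\<close> have "c > 0" by (cases "c = 0") auto
  have "V N \<le> 1 / (pi * c)" for N
  proof -
    have pos: "v + V N > 0" using V0[of N] v by linarith
    have "c \<le> 1 / (pi * (v + V N))"
      using c[of N] pos unfolding c_def(1) by (simp add: cgauss_density_def ennreal_le_iff)
    then have "v + V N \<le> 1 / (pi * c)"
      using pos \<open>c > 0\<close> by (simp add: pos_le_divide_eq mult_ac)
    then show ?thesis using v by simp
  qed
  then show summ: ?summable
    unfolding V_def using \<alpha> by (intro summableI_nonneg_bounded) (auto simp: less_imp_le)
  have "V \<longlonglongrightarrow> (\<Sum>l. \<alpha> l * (cmod (x l))\<^sup>2)"
    unfolding V_def using summ by (rule summable_LIMSEQ)
  moreover have "(\<Sum>l. \<alpha> l * (cmod (x l))\<^sup>2) \<ge> 0" using \<alpha> by (intro suminf_nonneg summ)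
      (auto simp: less_imp_le)
  ultimately have "(\<lambda>N. ennreal (cgauss_density (v + V N) y)) \<longlonglongrightarrow> ennreal
      (cgauss_density (v + (\<Sum>l. \<alpha> l * (cmod (x l))\<^sup>2)) y)"
    using v unfolding cgauss_density_def by (intro tendsto_intros tendsto_ennrealI) auto
  from LIMSEQ_unique[OF lim[of y] this] show ?eq .
qed

section \<open>Gaussian vectors\<close>

definition cgauss_vec_density :: "'k set \<Rightarrow> ('k \<Rightarrow> real) \<Rightarrow> ('k \<Rightarrow> complex) \<Rightarrow> real" where
  "cgauss_vec_density K v y = (\<Prod>k\<in>K. cgauss_density (v k) (y k))"

lemma cgauss_vec_density_pos: "(\<And>k. k \<in> K \<Longrightarrow> v k > 0) \<Longrightarrow> cgauss_vec_density K v y > 0"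
  unfolding cgauss_vec_density_def by (intro prod_pos) (auto intro: cgauss_density_pos)

lemma ennreal_cgauss_vec_density:
  "(\<And>k. k \<in> K \<Longrightarrow> v k > 0) \<Longrightarrow> ennreal (cgauss_vec_density K v y)
      = (\<Prod>k\<in>K. ennreal (cgauss_density (v k) (y k)))"
  unfolding cgauss_vec_density_def by (intro prod_ennreal[symmetric]) (auto intro: cgauss_density_nonneg)

lemma ln_cgauss_vec_density:
  assumes "\<And>k. k \<in> K \<Longrightarrow> v k > 0"
  shows "ln (cgauss_vec_density K v y) = (\<Sum>k\<in>K. - ((cmod (y k))\<^sup>2 / v k) - ln (pi * v k))"
proof (cases "finite K")
  case True
  have "ln (cgauss_density (v k) z) = - ((cmod z)\<^sup>2 / v k) - ln (pi * v k)" if "k \<in> K" for k z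
    using assms[OF that] unfolding cgauss_density_def by (subst ln_div) auto
  then show ?thesis
    unfolding cgauss_vec_density_def using True assms
    by (subst ln_prod) (auto simp: less_imp_neq[OF cgauss_density_pos, symmetric])
qed (simp add: cgauss_vec_density_def)

lemma product_prob_space_complex_gaussian:
  "(\<And>k. v k > 0) \<Longrightarrow> product_prob_space (\<lambda>k. complex_gaussian (v k))"
  by (intro product_prob_spaceI prob_space_complex_gaussian)

lemma product_sigma_finite_complex_gaussian:
  "(\<And>k. v k > 0) \<Longrightarrow> product_sigma_finite (\<lambda>k. complex_gaussian (v k))"
  using product_prob_space_complex_gaussian by (rule product_prob_space.axioms)

lemma product_sigma_finite_lborel: "product_sigma_finite (\<lambda>_. lborel :: 'a::euclidean_space measure)"
  by (simp add: product_sigma_finite_def sigma_finite_lborel)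

lemma prob_space_PiM_complex_gaussian: "(\<And>k. v k > 0) \<Longrightarrow> prob_space (PiM K (\<lambda>k. complex_gaussian (v k)))"
  by (intro prob_space_PiM prob_space_complex_gaussian)

lemma sets_PiM_complex_gaussian: "sets (PiM K (\<lambda>k. complex_gaussian (v k))) = sets (PiM K (\<lambda>_. borel))"
  by (intro sets_PiM_cong) auto

lemma sets_PiM_lborel: "sets (PiM K (\<lambda>_. lborel)) = sets (PiM K (\<lambda>_. borel))"
  by (intro sets_PiM_cong) auto

lemma PiM_complex_gaussian_eq_density:
  assumes "finite K" "\<And>k. v k > 0"
  shows "PiM K (\<lambda>k. complex_gaussian (v k)) = density (PiM K (\<lambda>_. lborel))
      (\<lambda>y. ennreal (cgauss_vec_density K v y))"
proof -
  have "PiM K (\<lambda>k. complex_gaussian (v k)) = density (PiM K (\<lambda>_. lborel))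
      (\<lambda>y. \<Prod>k\<in>K. ennreal (cgauss_density (v k) (y k)))"
    using assms product_sigma_finite_complex_gaussian[of v]
    unfolding complex_gaussian_eq
    by (intro PiM_density_finite product_sigma_finite_lborel) auto
  then show ?thesis by (simp add: ennreal_cgauss_vec_density assms)
qed

lemma nn_integral_PiM_complex_gaussian:
  assumes "finite K" "\<And>k. v k > 0" and [measurable]: "f \<in> borel_measurable (PiM K (\<lambda>_. borel))"
  shows "(\<integral>\<^sup>+ y. f y \<partial>PiM K (\<lambda>k. complex_gaussian (v k))) =
    (\<integral>\<^sup>+ y. ennreal (cgauss_vec_density K v y) * f y \<partial>PiM K (\<lambda>_. lborel))"
proof -
  note sets_PiM_lborel[measurable_cong]
  have "f \<in> borel_measurable (PiM K (\<lambda>_. lborel))" by simp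
  moreover have "(\<lambda>y. ennreal (cgauss_vec_density K v y)) \<in> borel_measurable (PiM K (\<lambda>_. lborel))"
    unfolding cgauss_vec_density_def by measurable
  ultimately show ?thesis
    unfolding PiM_complex_gaussian_eq_density[OF assms(1,2)] by (rule nn_integral_density[rotated])
qed

lemma nn_integral_PiM_cgauss_scale:
  assumes "finite K" and c: "\<And>k. c k > 0" and f[measurable]: "f \<in> borel_measurable (PiM K (\<lambda>_. borel))"
  shows "(\<integral>\<^sup>+ g. f (\<lambda>k\<in>K. of_real (c k) * g k) \<partial>PiM K (\<lambda>_. complex_gaussian 1)) =
    (\<integral>\<^sup>+ y. f y \<partial>PiM K (\<lambda>k. complex_gaussian ((c k)\<^sup>2)))"
proof -
  note sets_PiM_complex_gaussian[measurable_cong]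
  have *: "distr (complex_gaussian 1) borel (\<lambda>z. of_real (c k) * z) = complex_gaussian ((c k)\<^sup>2)" for k
  proof (rule measure_eqI)
    fix A assume "A \<in> sets (distr (complex_gaussian 1) borel (\<lambda>z. of_real (c k) * z))"
    then have [measurable]: "A \<in> sets borel" by simp
    have "emeasure (distr (complex_gaussian 1) borel (\<lambda>z. of_real (c k) * z)) A =
       (\<integral>\<^sup>+ z. indicator A z \<partial>distr (complex_gaussian 1) borel (\<lambda>z. of_real (c k) * z))"
      by simp
    also have "\<dots> = (\<integral>\<^sup>+ z. indicator A z \<partial>complex_gaussian ((c k)\<^sup>2))"
      by (subst nn_integral_distr) (auto simp: nn_integral_cgauss_scale[OF _ c])
    also have "\<dots> = emeasure (complex_gaussian ((c k)\<^sup>2)) A"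
      by (subst nn_integral_indicator) auto
    finally show "emeasure (distr (complex_gaussian 1) borel (\<lambda>z. of_real (c k) * z)) A = emeasure
        (complex_gaussian ((c k)\<^sup>2)) A" .
  qed simp
  have c2: "(c k)\<^sup>2 > 0" for k using c[of k] by simp
  have "PiM K (\<lambda>k. distr (complex_gaussian 1) borel (\<lambda>z. of_real (c k) * z)) =
      distr (PiM K (\<lambda>_. complex_gaussian 1)) (PiM K (\<lambda>_. borel)) (\<lambda>y. \<lambda>k\<in>K. of_real (c k) * y k)"
    using assms(1) product_sigma_finite_complex_gaussian[OF c2]
    by (intro PiM_distr_finite) (auto simp: * product_sigma_finite_complex_gaussian)
  then show ?thesis
    unfolding * by (simp add: nn_integral_distr)
qed

lemma nn_integral_PiM_lborel_shift:
  fixes f :: "('k \<Rightarrow> complex) \<Rightarrow> ennreal"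
  assumes "finite K" and f[measurable]: "f \<in> borel_measurable (PiM K (\<lambda>_. borel))"
  shows "(\<integral>\<^sup>+ y. f (\<lambda>k\<in>K. c k + y k) \<partial>PiM K (\<lambda>_. lborel)) = (\<integral>\<^sup>+ y. f y \<partial>PiM K (\<lambda>_. lborel))"
proof -
  note sets_PiM_lborel[measurable_cong]
  have *: "distr (lborel :: complex measure) borel (\<lambda>z. c k + z) = lborel" for k
    using lborel_distr_plus[of "c k"] by simp
  have eq: "PiM K (\<lambda>k. distr (lborel :: complex measure) borel (\<lambda>z. c k + z)) =
      distr (PiM K (\<lambda>_. lborel)) (PiM K (\<lambda>_. borel)) (\<lambda>y. \<lambda>k\<in>K. c k + y k)"
    using assms(1)
    by (intro PiM_distr_finite product_sigma_finite_lborel) (auto simp: * product_sigma_finite_lborel)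
  then show ?thesis
    by (subst (2) eq[unfolded *]) (simp add: nn_integral_distr)
qed

lemma nn_integral_PiM_cgauss_shift:
  assumes "finite K" "\<And>k. v k > 0" and f[measurable]: "f \<in> borel_measurable (PiM K (\<lambda>_. borel))"
  shows "(\<integral>\<^sup>+ z. f (\<lambda>k\<in>K. c k + z k) \<partial>PiM K (\<lambda>k. complex_gaussian (v k))) =
    (\<integral>\<^sup>+ y. ennreal (cgauss_vec_density K v (\<lambda>k. y k - c k)) * f y \<partial>PiM K (\<lambda>_. lborel))"
proof -
  have [measurable]: "(\<lambda>z. \<lambda>k\<in>K. c k + z k) \<in> measurable (PiM K (\<lambda>_. borel)) (PiM K (\<lambda>_. borel))"
    by measurable
  have "(\<integral>\<^sup>+ z. f (\<lambda>k\<in>K. c k + z k) \<partial>PiM K (\<lambda>k. complex_gaussian (v k))) =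
      (\<integral>\<^sup>+ z. ennreal (cgauss_vec_density K v z) * f (\<lambda>k\<in>K. c k + z k) \<partial>PiM K (\<lambda>_. lborel))"
    using assms(1,2) by (rule nn_integral_PiM_complex_gaussian) measurable
  also have "\<dots> = (\<integral>\<^sup>+ z. (\<lambda>y. ennreal (cgauss_vec_density K v (\<lambda>k. y k - c k)) * f y)
      (\<lambda>k\<in>K. c k + z k) \<partial>PiM K (\<lambda>_. lborel))"
    by (simp add: cgauss_vec_density_def)
  also have "\<dots> = (\<integral>\<^sup>+ y. ennreal (cgauss_vec_density K v (\<lambda>k. y k - c k)) * f y \<partial>PiM K (\<lambda>_. lborel))"
    using assms(1) by (rule nn_integral_PiM_lborel_shift) (unfold cgauss_vec_density_def, measurable)
  finally show ?thesis .
qed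

text \<open>This removes the fading of the transmitter, which has unit variance, independently at
  each time.\<close>

lemma nn_integral_cgauss_vec_convolution:
  assumes "finite K" and v: "\<And>k. v k > 0"
  shows "(\<integral>\<^sup>+ w. ennreal (cgauss_vec_density K v (\<lambda>k. y k - w k * x k)) \<partial>PiM K
      (\<lambda>_. complex_gaussian 1)) =
    ennreal (cgauss_vec_density K (\<lambda>k. v k + (cmod (x k))\<^sup>2) y)"
proof -
  interpret product_sigma_finite "\<lambda>_. complex_gaussian 1"
    by (rule product_sigma_finite_complex_gaussian) simp
  have "v k + (cmod (x k))\<^sup>2 > 0" for k using v by (intro add_pos_nonneg) auto
  then show ?thesis
    using v assms(1)
    by (simp add: ennreal_cgauss_vec_density
      product_nn_integral_prod[where f="\<lambda>k u. ennreal (cgauss_density (v k) (y k - u * x k))"]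
      nn_integral_cgauss_convolution)
qed

lemma measurable_weighted_series:
  fixes c :: "nat \<Rightarrow> complex"
  shows "(\<lambda>g. g 0 * c 0 + (\<Sum>l. g (Suc l) * c (Suc l))) \<in> borel_measurable
      (PiM UNIV (\<lambda>l. complex_gaussian (\<alpha> l)))"
  by measurable

lemma cgauss_vec_second_moment:
  assumes "finite K" and v: "\<And>k. v k > 0" and k: "k \<in> K"
  shows "(\<integral>\<^sup>+ y. ennreal (cgauss_vec_density K v y) * ennreal ((cmod (y k))\<^sup>2) \<partial>PiM K (\<lambda>_. lborel))
      = ennreal (v k)"
proof -
  note sets_PiM_complex_gaussian[measurable_cong]
  have "(\<integral>\<^sup>+ y. ennreal (cgauss_vec_density K v y) * ennreal ((cmod (y k))\<^sup>2) \<partial>PiM K (\<lambda>_. lborel)) =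
      (\<integral>\<^sup>+ y. ennreal ((cmod (y k))\<^sup>2) \<partial>PiM K (\<lambda>k. complex_gaussian (v k)))"
    using assms by (subst nn_integral_PiM_complex_gaussian) auto
  also have "\<dots> = (\<integral>\<^sup>+ z. ennreal ((cmod z)\<^sup>2) \<partial>distr (PiM K (\<lambda>k. complex_gaussian (v k)))
      (complex_gaussian (v k)) (\<lambda>y. y k))"
    using k by (subst nn_integral_distr) measurable
  also have "\<dots> = ennreal (v k)"
    using v k by (subst distr_PiM_component)
        (auto intro: prob_space_complex_gaussian complex_gaussian_second_moment)
  finally show ?thesis .
qed

text \<open>Convergence is assumed under the joint law of blocks, fading and noise, while the
  Gaussian computation fixes the blocks and looks at one column of fading. Fubini yields the first
  reduction, the law of a column the second; the transmitter adds a single term to the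
  series.\<close>

lemma AE_output_series_converges:
  fixes \<alpha> :: "nat \<Rightarrow> real"
  assumes \<alpha>: "\<And>l. \<alpha> l > 0" and \<sigma>: "\<sigma>2 > 0" and Q: "prob_space Q" "sets Q = sets (block_space n)"
    and k: "k \<in> {1..n}"
    and conv: "AE \<omega> in channel_space \<alpha> \<sigma>2 n Q. summable (interference_term k \<omega>)"
  shows "AE x in PiM UNIV (\<lambda>_. Q). AE g in PiM UNIV (\<lambda>l. complex_gaussian (\<alpha> l)).
    (\<lambda>N. \<Sum>l<N. g l * x l k) \<longlonglongrightarrow> g 0 * x 0 k + (\<Sum>l. g (Suc l) * x (Suc l) k)"
proof -
  let ?C = "\<lambda>l. complex_gaussian (\<alpha> l)"
  let ?C' = "\<lambda>(l, k :: nat). complex_gaussian (\<alpha> l)"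
  let ?H = "PiM (UNIV \<times> {1..n}) ?C'"
  let ?Z = "PiM {1..n} (\<lambda>_. complex_gaussian \<sigma>2)"
  interpret X: prob_space "PiM UNIV (\<lambda>_::nat. Q)" by (intro prob_space_PiM Q)
  interpret H: prob_space ?H by (intro prob_space_PiM) (auto intro!: prob_space_complex_gaussian \<alpha>)
  interpret Z: prob_space ?Z by (intro prob_space_PiM prob_space_complex_gaussian \<sigma>)
  interpret HZ: pair_prob_space ?H ?Z ..
  interpret XHZ: pair_prob_space "PiM UNIV (\<lambda>_::nat. Q)" "?H \<Otimes>\<^sub>M ?Z" ..
  have "AE x in PiM UNIV (\<lambda>_. Q). AE h in ?H. summable (\<lambda>l. h (Suc l, k) * x (Suc l) k)"
  proof -
    from XHZ.AE_pair[OF conv[unfolded channel_space_def]]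
    show ?thesis
      by eventually_elim (drule HZ.AE_pair, simp add: interference_term_def)
  qed
  then show ?thesis
  proof eventually_elim
    case (elim x)
    have [measurable]: "Measurable.pred (PiM UNIV ?C) (\<lambda>g. summable (\<lambda>l. g (Suc l) * x (Suc l) k))"
      unfolding summable_iff_convergent Cauchy_convergent_iff[symmetric] pred_def
      by measurable
    have H_eq: "distr ?H (PiM UNIV ?C) (\<lambda>\<omega> l. \<omega> (l, k)) = PiM UNIV ?C"
      by (intro distr_PiM_column prob_space_complex_gaussian \<alpha> k)
    have [measurable]: "(\<lambda>\<omega> l. \<omega> (l, k)) \<in> measurable ?H (PiM UNIV ?C)"
      by (rule measurable_PiM_column) (use k in auto)
    have "AE g in PiM UNIV ?C. summable (\<lambda>l. g (Suc l) * x (Suc l) k)"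
      using elim by (subst H_eq[symmetric], subst AE_distr_iff) (simp_all del: One_nat_def)
    then show ?case
    proof eventually_elim
      case (elim g)
      then have "summable (\<lambda>l. g l * x l k)" by (subst (asm) summable_Suc_iff)
      then show ?case
        using suminf_split_head[of "\<lambda>l. g l * x l k"] summable_LIMSEQ[of "\<lambda>l. g l * x l k"] by simp
    qed
  qed
qed

section \<open>The channel at a fixed block length\<close>

text \<open>Turns an exponential lower bound and a constant upper bound on a density into a bound on
  its logarithm that can be integrated.\<close>

lemma abs_ln_le:
  fixes u p b :: real
  assumes "exp (- u) \<le> p" "p \<le> b"
  shows "\<bar>ln p\<bar> \<le> \<bar>u\<bar> + \<bar>ln b\<bar>"
proof -
  have p: "p > 0" using assms(1) exp_gt_zero[of "- u"] by linarith
  then have "- u \<le> ln p" using assms(1) by (simp add: ln_ge_iff)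
  moreover have "ln p \<le> ln b" using p assms(2) by simp
  ultimately show ?thesis by linarith
qed

lemma enn2real_suminf_eq:
  fixes f :: "nat \<Rightarrow> real"
  assumes "summable f" "\<And>l. f l \<ge> 0"
  shows "enn2real (\<Sum>l. ennreal (f l)) = (\<Sum>l. f l)"
  using assms by (subst suminf_ennreal2) (auto intro!: suminf_nonneg enn2real_ennreal)

text \<open>\<open>summable_\<alpha>\<close> comes from convergence under all admissible input laws
  together; convergence under \<open>Q\<close> alone would not give it, as a \<open>Q\<close>
  concentrated at the zero block shows.\<close>

locale channel_block =
  fixes \<alpha> :: "nat \<Rightarrow> real" and \<sigma>2 P :: real and n :: nat and Q :: "(nat \<Rightarrow> complex) measure"
  assumes \<alpha>_0: "\<alpha> 0 = 1" and \<alpha>_pos: "\<And>l. \<alpha> l > 0" and summable_\<alpha>: "summable \<alpha>"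
    and \<sigma>2_pos: "\<sigma>2 > 0"
    and Q_admissible: "Q \<in> admissible_inputs P n"
    and converges: "\<And>k. k \<in> {1..n} \<Longrightarrow> AE \<omega> in channel_space \<alpha> \<sigma>2 n Q. summable (interference_term k \<omega>)"
begin

declare One_nat_def [simp del]

abbreviation "XS \<equiv> PiM UNIV (\<lambda>_::nat. Q)"
abbreviation "W \<equiv> PiM {1..n} (\<lambda>_. complex_gaussian 1)"
abbreviation "L \<equiv> PiM {1..n} (\<lambda>_. lborel :: complex measure)"

definition received_power :: "(nat \<Rightarrow> nat \<Rightarrow> complex) \<Rightarrow> nat \<Rightarrow> real" where
  "received_power x k = \<sigma>2 + enn2real (\<Sum>l. ennreal (\<alpha> l * (cmod (x l k))\<^sup>2))"

text \<open>Both powers take the junk value \<open>\<sigma>2\<close> where the series diverges, so they are positive everywhere.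
  In the second one the blocks of the interferers are numbered from 0, so that \<open>s l\<close> is the block of
  interferer \<open>l + 1\<close>.\<close>

definition interference_power :: "(nat \<Rightarrow> nat \<Rightarrow> complex) \<Rightarrow> nat \<Rightarrow> real" where
  "interference_power s k = \<sigma>2 + enn2real (\<Sum>l. ennreal (\<alpha> (Suc l) * (cmod (s l k))\<^sup>2))"

text \<open>Both weightings occur because one sequence of blocks is read in two ways: as the blocks
  of all users and as those of the interferers alone.\<close>

definition finite_power :: "(nat \<Rightarrow> nat \<Rightarrow> complex) \<Rightarrow> bool" where
  "finite_power x \<longleftrightarrow> (\<forall>k\<in>{1..n}. summable (\<lambda>l. \<alpha> l * (cmod (x l k))\<^sup>2) \<and>
    summable (\<lambda>l. \<alpha> (Suc l) * (cmod (x l k))\<^sup>2))"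

sublocale Q: prob_space Q
  using Q_admissible by (simp add: admissible_inputs_def)

lemma sets_Q[measurable_cong]: "sets Q = sets (block_space n)"
  using Q_admissible by (simp add: admissible_inputs_def)

sublocale XS: sequence_space Q ..
sublocale W: prob_space W by (rule prob_space_PiM_complex_gaussian) simp
sublocale L: finite_product_sigma_finite "\<lambda>_. lborel :: complex measure" "{1..n}"
  by standard (auto simp: sigma_finite_lborel)

lemma sets_L[measurable_cong]: "sets L = sets (block_space n)"
  by (rule sets_PiM_lborel)

lemma sets_W[measurable_cong]: "sets W = sets (block_space n)"
  by (rule sets_PiM_complex_gaussian)

lemma measurable_symbol[measurable (raw)]:
  assumes x: "x \<in> measurable M XS" and k: "k \<in> {1..n}"
  shows "(\<lambda>\<omega>. x \<omega> l k) \<in> borel_measurable M"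
proof -
  have "(\<lambda>\<omega>. x \<omega> l) \<in> measurable M (block_space n)"
    using measurable_compose[OF x measurable_component_singleton[of l UNIV "\<lambda>_. Q"]]
    by (simp cong: measurable_cong_sets add: sets_Q)
  from measurable_compose[OF this measurable_component_singleton[OF k]] show ?thesis by simp
qed

lemma measurable_received_power[measurable]:
  assumes [measurable]: "x \<in> measurable M XS" "k \<in> {1..n}"
  shows "(\<lambda>\<omega>. received_power (x \<omega>) k) \<in> borel_measurable M"
  unfolding received_power_def by measurable

lemma measurable_interference_power[measurable]:
  assumes [measurable]: "x \<in> measurable M XS" "k \<in> {1..n}"
  shows "(\<lambda>\<omega>. interference_power (x \<omega>) k) \<in> borel_measurable M"
  unfolding interference_power_def by measurable

lemma power_ge_\<sigma>2:
  "received_power x k \<ge> \<sigma>2" "interference_power x k \<ge> \<sigma>2"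
  unfolding received_power_def interference_power_def by auto

lemma power_pos: "received_power x k > 0" "interference_power x k > 0"
  using power_ge_\<sigma>2 \<sigma>2_pos less_le_trans by blast+

lemma received_power_eq:
  assumes "summable (\<lambda>l. \<alpha> l * (cmod (x l k))\<^sup>2)"
  shows "received_power x k = \<sigma>2 + (\<Sum>l. \<alpha> l * (cmod (x l k))\<^sup>2)"
  using assms \<alpha>_pos unfolding received_power_def by (simp add: enn2real_suminf_eq less_imp_le)

lemma interference_power_eq:
  assumes "summable (\<lambda>l. \<alpha> (Suc l) * (cmod (s l k))\<^sup>2)"
  shows "interference_power s k = \<sigma>2 + (\<Sum>l. \<alpha> (Suc l) * (cmod (s l k))\<^sup>2)"
  using assms \<alpha>_pos unfolding interference_power_def by (simp add: enn2real_suminf_eq less_imp_le)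

text \<open>Putting the block \<open>a\<close> of the transmitter in front moves interferer blocks
  from index \<open>l\<close> to \<open>Suc l\<close>, which matches the weights in
  \<open>interference_power\<close>; the new term has coefficient \<open>\<alpha> 0\<close>, which
  is 1.\<close>

lemma received_power_case_nat:
  assumes "finite_power s" "k \<in> {1..n}"
  shows "received_power (case_nat a s) k = interference_power s k + (cmod (a k))\<^sup>2"
proof -
  let ?f = "\<lambda>l. \<alpha> l * (cmod (case_nat a s l k))\<^sup>2"
  have s: "summable (\<lambda>l. \<alpha> (Suc l) * (cmod (s l k))\<^sup>2)"
    using assms by (auto simp: finite_power_def)
  then have "summable ?f" by (subst summable_Suc_iff[symmetric]) simp
  then show ?thesis
    using suminf_split_head[of ?f] by (simp add: received_power_eq
        interference_power_eq[of s k, OF s] \<alpha>_0)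
qed

lemma measurable_cgauss_vec_density[measurable]:
  assumes "\<And>k. k \<in> {1..n} \<Longrightarrow> (\<lambda>\<omega>. v \<omega> k) \<in> borel_measurable M"
    and "\<And>k. k \<in> {1..n} \<Longrightarrow> (\<lambda>\<omega>. y \<omega> k) \<in> borel_measurable M"
  shows "(\<lambda>\<omega>. cgauss_vec_density {1..n} (v \<omega>) (y \<omega>)) \<in> borel_measurable M"
  unfolding cgauss_vec_density_def by (intro borel_measurable_prod measurable_cgauss_density assms)

lemma measurable_block_component[measurable (raw)]:
  assumes y: "y \<in> measurable M (block_space n)" and k: "k \<in> {1..n}"
  shows "(\<lambda>\<omega>. y \<omega> k) \<in> borel_measurable M"
  using measurable_compose[OF y measurable_component_singleton[OF k]] by simp

section \<open>Law of the output given all blocks\<close>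

abbreviation "H \<equiv> PiM (UNIV \<times> {1..n}) (\<lambda>(l, k). complex_gaussian (\<alpha> l))"
abbreviation "Z \<equiv> PiM {1..n} (\<lambda>_. complex_gaussian \<sigma>2)"

sublocale H: prob_space H
  by (intro prob_space_PiM) (auto intro!: prob_space_complex_gaussian \<alpha>_pos)

sublocale Z: prob_space Z
  by (intro prob_space_PiM_complex_gaussian \<sigma>2_pos)

lemma channel_space_eq: "channel_space \<alpha> \<sigma>2 n Q = XS \<Otimes>\<^sub>M (H \<Otimes>\<^sub>M Z)"
  unfolding channel_space_def ..

sublocale HZ: pair_prob_space H Z ..
sublocale XHZ: pair_prob_space XS "H \<Otimes>\<^sub>M Z" ..

lemma measurable_channel_input[measurable]:
  "channel_input \<in> measurable (channel_space \<alpha> \<sigma>2 n Q) (block_space n)"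
proof -
  have "(\<lambda>\<omega>. fst \<omega> 0) \<in> measurable (XS \<Otimes>\<^sub>M (H \<Otimes>\<^sub>M Z)) Q" by measurable
  then show ?thesis
    unfolding channel_space_eq channel_input_def case_prod_unfold
    by (simp cong: measurable_cong_sets add: sets_Q)
qed

lemma measurable_channel_output[measurable]:
  "channel_output n \<in> measurable (channel_space \<alpha> \<sigma>2 n Q) (block_space n)"
  unfolding channel_space_eq channel_output_def case_prod_unfold interference_term_def
  by measurable

text \<open>For fixed fading the noise gives the output a Gaussian density centred at the received
  signal. Exchanging integrals, this density is averaged over the fading; the average factors over
  time, and each factor is the Gaussian series computed above.\<close>

lemma nn_integral_channel_given_input:
  assumes f[measurable]: "f \<in> borel_measurable (block_space n)"
    and conv: "\<And>k. k \<in> {1..n} \<Longrightarrow> AE g in PiM UNIV (\<lambda>l. complex_gaussian (\<alpha> l)).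
      (\<lambda>N. \<Sum>l<N. g l * x l k) \<longlonglongrightarrow> g 0 * x 0 k + (\<Sum>l. g (Suc l) * x (Suc l) k)"
  shows "(\<integral>\<^sup>+ h. \<integral>\<^sup>+ z. f (channel_output n (x, h, z)) \<partial>Z \<partial>H) =
    (\<integral>\<^sup>+ y. ennreal (cgauss_vec_density {1..n} (received_power x) y) * f y \<partial>L)"
proof -
  define S where "S g k = g 0 * x 0 k + (\<Sum>l. g (Suc l) * x (Suc l) k)" for g k
  let ?S = "\<lambda>h k. S (\<lambda>l. h (l, k)) k"
  let ?C = "\<lambda>l. complex_gaussian (\<alpha> l)"
  have S[measurable]: "(\<lambda>g. S g k) \<in> borel_measurable (PiM UNIV ?C)" for k
    unfolding S_def by (rule measurable_weighted_series)
  have fin: "summable (\<lambda>l. \<alpha> l * (cmod (x l k))\<^sup>2)" if "k \<in> {1..n}" for k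
    using nn_integral_cgauss_infinite_sum(1)[OF \<alpha>_pos \<sigma>2_pos S[unfolded S_def] conv[OF that]] .
  have S'[measurable]: "(\<lambda>\<omega>. ?S (h \<omega>) k) \<in> borel_measurable M" if "h \<in> measurable M H" "k \<in> {1..n}"
      for h k and M :: "'a measure"
    by (rule measurable_compose[OF measurable_compose[OF that(1) measurable_PiM_column] S])
      (use that(2) in auto)
  have "(\<integral>\<^sup>+ h. \<integral>\<^sup>+ z. f (channel_output n (x, h, z)) \<partial>Z \<partial>H)
      = (\<integral>\<^sup>+ h. \<integral>\<^sup>+ z. f (\<lambda>k\<in>{1..n}. ?S h k + z k) \<partial>Z \<partial>H)"
    by (simp add: channel_output_def interference_term_def S_def)
  also have "\<dots> = (\<integral>\<^sup>+ h. \<integral>\<^sup>+ y. ennreal (cgauss_vec_density {1..n} (\<lambda>_. \<sigma>2) (\<lambda>k. y k - ?S h k))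
      * f y \<partial>L \<partial>H)"
    using \<sigma>2_pos f by (subst nn_integral_PiM_cgauss_shift) auto
  also have "\<dots> = (\<integral>\<^sup>+ y. \<integral>\<^sup>+ h. ennreal (cgauss_vec_density {1..n} (\<lambda>_. \<sigma>2) (\<lambda>k. y k - ?S h k))
      * f y \<partial>H \<partial>L)"
    by (intro pair_sigma_finite.Fubini' pair_sigma_finite.intro H.sigma_finite_measure_axioms
        L.sigma_finite_measure_axioms) measurable
  also have "\<dots> = (\<integral>\<^sup>+ y. (\<integral>\<^sup>+ h. ennreal (cgauss_vec_density {1..n} (\<lambda>_. \<sigma>2) (\<lambda>k. y k - ?S h k)) \<partial>H)
      * f y \<partial>L)"
    by (intro nn_integral_cong nn_integral_multc) measurable
  also have "\<dots> = (\<integral>\<^sup>+ y. ennreal (cgauss_vec_density {1..n} (received_power x) y) * f y \<partial>L)"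
  proof (intro nn_integral_cong arg_cong2[where f=times] refl)
    fix y
    have "(\<integral>\<^sup>+ h. ennreal (cgauss_vec_density {1..n} (\<lambda>_. \<sigma>2) (\<lambda>k. y k - ?S h k)) \<partial>H) =
      (\<integral>\<^sup>+ h. (\<Prod>k\<in>{1..n}. (\<lambda>g. ennreal (cgauss_density \<sigma>2 (y k - S g k))) (\<lambda>l. h (l, k))) \<partial>H)"
      using \<sigma>2_pos by (simp add: ennreal_cgauss_vec_density)
    also have "\<dots> = (\<Prod>k\<in>{1..n}. \<integral>\<^sup>+ g. ennreal (cgauss_density \<sigma>2 (y k - S g k)) \<partial>PiM UNIV ?C)"
      by (rule nn_integral_PiM_columns) (auto intro!: prob_space_complex_gaussian \<alpha>_pos)
    also have "\<dots> = (\<Prod>k\<in>{1..n}. ennreal (cgauss_density (received_power x k) (y k)))"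
      using S conv
      by (intro prod.cong refl)
        (simp add: received_power_eq[OF fin] nn_integral_cgauss_infinite_sum(2)[OF \<alpha>_pos \<sigma>2_pos] S_def)
    finally show "(\<integral>\<^sup>+ h. ennreal (cgauss_vec_density {1..n} (\<lambda>_. \<sigma>2) (\<lambda>k. y k - ?S h k)) \<partial>H) =
        ennreal (cgauss_vec_density {1..n} (received_power x) y)"
      using power_pos by (simp add: ennreal_cgauss_vec_density)
  qed
  finally show ?thesis .
qed

lemma nn_integral_channel:
  assumes f[measurable]: "f \<in> borel_measurable (block_space n \<Otimes>\<^sub>M block_space n)"
  shows "(\<integral>\<^sup>+ \<omega>. f (channel_input \<omega>, channel_output n \<omega>) \<partial>channel_space \<alpha> \<sigma>2 n Q) =
    (\<integral>\<^sup>+ x. \<integral>\<^sup>+ y. ennreal (cgauss_vec_density {1..n} (received_power x) y) * f (x 0, y) \<partial>L \<partial>XS)"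
proof -
  have [measurable]: "(\<lambda>\<omega>. f (channel_input \<omega>, channel_output n \<omega>)) \<in> borel_measurable
      (XS \<Otimes>\<^sub>M (H \<Otimes>\<^sub>M Z))"
    using measurable_channel_input measurable_channel_output unfolding channel_space_eq by measurable
  have "(\<integral>\<^sup>+ \<omega>. f (channel_input \<omega>, channel_output n \<omega>) \<partial>channel_space \<alpha> \<sigma>2 n Q) =
      (\<integral>\<^sup>+ x. \<integral>\<^sup>+ hz. f (channel_input (x, hz), channel_output n (x, hz)) \<partial>(H \<Otimes>\<^sub>M Z) \<partial>XS)"
    unfolding channel_space_eq
    by (intro HZ.P.nn_integral_fst[symmetric]) measurable
  also have "\<dots> = (\<integral>\<^sup>+ x. \<integral>\<^sup>+ h. \<integral>\<^sup>+ z. f (x 0, channel_output n (x, h, z)) \<partial>Z \<partial>H \<partial>XS)"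
  proof (intro nn_integral_cong)
    fix x assume [measurable]: "x \<in> space XS"
    have "(\<integral>\<^sup>+ hz. f (channel_input (x, hz), channel_output n (x, hz)) \<partial>(H \<Otimes>\<^sub>M Z)) =
       (\<integral>\<^sup>+ h. \<integral>\<^sup>+ z. f (channel_input (x, h, z), channel_output n (x, h, z)) \<partial>Z \<partial>H)"
      by (intro Z.nn_integral_fst[symmetric]) measurable
    then show "(\<integral>\<^sup>+ hz. f (channel_input (x, hz), channel_output n (x, hz)) \<partial>(H \<Otimes>\<^sub>M Z)) =
      (\<integral>\<^sup>+ h. \<integral>\<^sup>+ z. f (x 0, channel_output n (x, h, z)) \<partial>Z \<partial>H)"
      by (simp add: channel_input_def)
  qed
  also have "\<dots> = (\<integral>\<^sup>+ x. \<integral>\<^sup>+ y. ennreal (cgauss_vec_density {1..n} (received_power x) y)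
      * f (x 0, y) \<partial>L \<partial>XS)"
  proof (rule nn_integral_cong_AE)
    have "AE x in XS. \<forall>k\<in>{1..n}. AE g in PiM UNIV (\<lambda>l. complex_gaussian (\<alpha> l)).
      (\<lambda>N. \<Sum>l<N. g l * x l k) \<longlonglongrightarrow> g 0 * x 0 k + (\<Sum>l. g (Suc l) * x (Suc l) k)"
      by (intro AE_finite_allI AE_output_series_converges[OF \<alpha>_pos \<sigma>2_pos Q.prob_space_axioms
          sets_Q] converges) simp_all
    then show "AE x in XS. (\<integral>\<^sup>+ h. \<integral>\<^sup>+ z. f (x 0, channel_output n (x, h, z)) \<partial>Z \<partial>H) =
      (\<integral>\<^sup>+ y. ennreal (cgauss_vec_density {1..n} (received_power x) y) * f (x 0, y) \<partial>L)"
      using AE_space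
    proof eventually_elim
      case (elim x)
      then have "x 0 \<in> space (block_space n)"
        using sets_eq_imp_space_eq[OF sets_Q] by (auto simp: space_PiM PiE_iff)
      from measurable_compose[OF measurable_Pair1'[OF this] f]
      have "(\<lambda>y. f (x 0, y)) \<in> borel_measurable (block_space n)" .
      then show ?case
        using elim by (intro nn_integral_channel_given_input[where f="\<lambda>y. f (x 0, y)"]) auto
    qed
  qed
  finally show ?thesis .
qed

section \<open>Integrals over the blocks and finiteness of the powers\<close>

lemma nn_integral_XS_component:
  assumes [measurable]: "f \<in> borel_measurable Q"
  shows "(\<integral>\<^sup>+ x. f (x l) \<partial>XS) = (\<integral>\<^sup>+ a. f a \<partial>Q)"
proof -
  have "(\<integral>\<^sup>+ a. f a \<partial>Q) = (\<integral>\<^sup>+ a. f a \<partial>distr XS Q (\<lambda>x. x l))"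
    by (subst distr_PiM_component) (auto intro: Q.prob_space_axioms)
  then show ?thesis by (simp add: nn_integral_distr)
qed

lemma nn_integral_XS_case_nat:
  assumes [measurable]: "f \<in> borel_measurable XS"
  shows "(\<integral>\<^sup>+ x. f x \<partial>XS) = (\<integral>\<^sup>+ a. \<integral>\<^sup>+ s. f (case_nat a s) \<partial>XS \<partial>Q)"
proof -
  have [measurable]: "(\<lambda>(a, s). case_nat a s) \<in> measurable (Q \<Otimes>\<^sub>M XS) XS"
    unfolding case_prod_unfold by measurable
  have "(\<integral>\<^sup>+ x. f x \<partial>XS) = (\<integral>\<^sup>+ x. f x \<partial>distr (Q \<Otimes>\<^sub>M XS) XS (\<lambda>(a, s). case_nat a s))"
    by (simp add: XS.PiM_iter)
  also have "\<dots> = (\<integral>\<^sup>+ p. f (case p of (a, s) \<Rightarrow> case_nat a s) \<partial>(Q \<Otimes>\<^sub>M XS))"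
    by (rule nn_integral_distr) measurable
  also have "\<dots> = (\<integral>\<^sup>+ a. \<integral>\<^sup>+ s. f (case_nat a s) \<partial>XS \<partial>Q)"
    by (subst XS.P.nn_integral_fst[symmetric]) (auto simp: case_prod_unfold)
  finally show ?thesis .
qed

text \<open>This is how the power constraint enters the estimates: each symbol has at most
  \<open>n\<close> times the average energy, hence a finite second moment. Integrability of the
  powers, and with it that of all log-densities, rests on this.\<close>

lemma symbol_energy_finite:
  assumes k: "k \<in> {1..n}"
  shows "(\<integral>\<^sup>+ a. ennreal ((cmod (a k))\<^sup>2) \<partial>Q) < \<infinity>"
proof -
  have n: "n > 0" using k by auto
  have "(\<integral>\<^sup>+ a. ennreal ((cmod (a k))\<^sup>2) \<partial>Q)
      \<le> (\<integral>\<^sup>+ a. ennreal (real n) * ennreal (1 / real n * (\<Sum>k=1..n. (cmod (a k))\<^sup>2)) \<partial>Q)"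
    using n k by (intro nn_integral_mono)
        (auto simp: ennreal_mult[symmetric] sum_nonneg intro!: ennreal_leI member_le_sum)
  also have "\<dots> = ennreal (real n) * (\<integral>\<^sup>+ a. ennreal (1 / real n * (\<Sum>k=1..n. (cmod (a k))\<^sup>2)) \<partial>Q)"
    by (rule nn_integral_cmult) measurable
  also have "\<dots> \<le> ennreal (real n) * ennreal P"
    using Q_admissible by (intro mult_left_mono) (auto simp: admissible_inputs_def)
  also have "\<dots> < \<infinity>" by (simp add: ennreal_mult_less_top)
  finally show ?thesis .
qed

text \<open>All blocks have the same law, so one second moment factors out of the series and only
  the weights remain to be summed.\<close>

lemma nn_integral_weighted_energy_finite:
  assumes "summable a" "\<And>l. a l > 0" and k: "k \<in> {1..n}"
  shows "(\<integral>\<^sup>+ x. (\<Sum>l. ennreal (a l * (cmod (x l k))\<^sup>2)) \<partial>XS) < \<infinity>"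
proof -
  define E where "E = (\<integral>\<^sup>+ a. ennreal ((cmod (a k))\<^sup>2) \<partial>Q)"
  have "(\<integral>\<^sup>+ x. (\<Sum>l. ennreal (a l * (cmod (x l k))\<^sup>2)) \<partial>XS)
      = (\<Sum>l. \<integral>\<^sup>+ x. ennreal (a l * (cmod (x l k))\<^sup>2) \<partial>XS)"
    using k by (intro nn_integral_suminf) measurable
  also have "\<dots> = (\<Sum>l. ennreal (a l) * E)"
  proof (intro suminf_cong)
    fix l
    have "(\<integral>\<^sup>+ x. ennreal (a l * (cmod (x l k))\<^sup>2) \<partial>XS)
        = (\<integral>\<^sup>+ x. ennreal (a l) * ennreal ((cmod (x l k))\<^sup>2) \<partial>XS)"
      using assms(2) by (simp add: ennreal_mult less_imp_le)
    also have "\<dots> = ennreal (a l) * E"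
      unfolding E_def using k nn_integral_XS_component[of "\<lambda>a. ennreal ((cmod (a k))\<^sup>2)" l]
      by (subst nn_integral_cmult) auto
    finally show "(\<integral>\<^sup>+ x. ennreal (a l * (cmod (x l k))\<^sup>2) \<partial>XS) = ennreal (a l) * E" .
  qed
  also have "\<dots> = ennreal (\<Sum>l. a l) * E"
    using assms(1,2) by (simp add: suminf_ennreal2 less_imp_le)
  also have "\<dots> < \<infinity>"
    using symbol_energy_finite[OF k] unfolding E_def by (simp add: ennreal_mult_less_top)
  finally show ?thesis .
qed

lemma AE_finite_power: "AE x in XS. finite_power x"
  unfolding finite_power_def
proof (rule AE_finite_allI)
  fix k assume k: "k \<in> {1..n}"
  have summ: "AE x in XS. summable (\<lambda>l. a l * (cmod (x l k))\<^sup>2)" if "summable a"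
      and a_pos: "\<And>l. a l > 0" for a :: "nat \<Rightarrow> real"
  proof -
    have [measurable]: "(\<lambda>x. \<Sum>l. ennreal (a l * (cmod (x l k))\<^sup>2)) \<in> borel_measurable XS"
      using k by measurable
    have "AE x in XS. (\<Sum>l. ennreal (a l * (cmod (x l k))\<^sup>2)) \<noteq> \<infinity>"
      using nn_integral_weighted_energy_finite[OF that k]
      by (intro nn_integral_PInf_AE) auto
    then show ?thesis
      by eventually_elim (use a_pos in \<open>auto intro!: summable_suminf_not_top simp: less_imp_le\<close>)
  qed
  show "AE x in XS. summable (\<lambda>l. \<alpha> l * (cmod (x l k))\<^sup>2) \<and> summable (\<lambda>l. \<alpha> (Suc l) * (cmod (x l k))\<^sup>2)"
    using summ[of \<alpha>] summ[of "\<lambda>l. \<alpha> (Suc l)"] summable_\<alpha> \<alpha>_pos by (simp add: summable_Suc_iff)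
qed simp

lemma integrable_weighted_energy:
  assumes "summable a" "\<And>l. a l > 0" and k: "k \<in> {1..n}"
  shows "integrable XS (\<lambda>x. enn2real (\<Sum>l. ennreal (a l * (cmod (x l k))\<^sup>2)))"
proof (rule integrableI_bounded)
  show "(\<lambda>x. enn2real (\<Sum>l. ennreal (a l * (cmod (x l k))\<^sup>2))) \<in> borel_measurable XS"
    using k by measurable
  have "(\<integral>\<^sup>+ x. ennreal (norm (enn2real (\<Sum>l. ennreal (a l * (cmod (x l k))\<^sup>2)))) \<partial>XS)
      \<le> (\<integral>\<^sup>+ x. (\<Sum>l. ennreal (a l * (cmod (x l k))\<^sup>2)) \<partial>XS)"
    by (intro nn_integral_mono) (simp add: ennreal_enn2real_if)
  also have "\<dots> < \<infinity>" by (rule nn_integral_weighted_energy_finite[OF assms])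
  finally show "(\<integral>\<^sup>+ x. ennreal (norm (enn2real (\<Sum>l. ennreal (a l * (cmod (x l k))\<^sup>2)))) \<partial>XS) < \<infinity>" .
qed

lemma integrable_power:
  assumes "k \<in> {1..n}"
  shows "integrable XS (\<lambda>x. received_power x k)" "integrable XS (\<lambda>x. interference_power x k)"
  unfolding received_power_def interference_power_def
  using summable_\<alpha> \<alpha>_pos assms
  by (auto intro!: Bochner_Integration.integrable_add integrable_weighted_energy simp: summable_Suc_iff)

section \<open>Mixture densities and bounds on their logarithms\<close>

definition density_bound :: real where
  "density_bound = (1 / (pi * \<sigma>2)) ^ n"

definition conditional_density :: "(nat \<Rightarrow> complex) \<Rightarrow> (nat \<Rightarrow> complex) \<Rightarrow> real" where
  "conditional_density a y = (\<integral>s. cgauss_vec_density {1..n}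
      (\<lambda>k. interference_power s k + (cmod (a k))\<^sup>2) y \<partial>XS)"

text \<open>Here \<open>s\<close> stands for the blocks of all users, transmitter included. As the
  users share one law, the mixture runs over the same \<open>XS\<close> as the average over the
  interferers in \<open>conditional_density\<close>.\<close>

definition output_density :: "(nat \<Rightarrow> complex) \<Rightarrow> real" where
  "output_density y = (\<integral>s. cgauss_vec_density {1..n} (received_power s) y \<partial>XS)"

lemma cgauss_vec_density_le_bound:
  assumes "\<And>k. k \<in> {1..n} \<Longrightarrow> v k \<ge> \<sigma>2"
  shows "cgauss_vec_density {1..n} v y \<le> density_bound"
proof -
  have "cgauss_density (v k) (y k) \<le> 1 / (pi * \<sigma>2)" if "k \<in> {1..n}" for k
    using assms[OF that] \<sigma>2_pos unfolding cgauss_density_def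
    by (intro frac_le) auto
  then have "cgauss_vec_density {1..n} v y \<le> (\<Prod>k\<in>{1..n}. 1 / (pi * \<sigma>2))"
    unfolding cgauss_vec_density_def using assms \<sigma>2_pos
    by (intro prod_mono conjI cgauss_density_nonneg) (auto intro: less_le_trans)
  then show ?thesis by (simp add: density_bound_def)
qed

text \<open>The prefactor 1 / (pi v) is weakened to exp (- pi v), so that the exponent of the whole
  bound is affine in the variances and Jensen's inequality applies to mixtures.\<close>

lemma cgauss_vec_density_ge_exp:
  assumes v: "\<And>k. k \<in> {1..n} \<Longrightarrow> v k \<ge> \<sigma>2"
  shows "exp (- (\<Sum>k=1..n. pi * v k + (cmod (y k))\<^sup>2 / \<sigma>2)) \<le> cgauss_vec_density {1..n} v y"
proof -
  have "exp (- (\<Sum>k=1..n. pi * v k + (cmod (y k))\<^sup>2 / \<sigma>2))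
      = (\<Prod>k=1..n. exp (- (pi * v k + (cmod (y k))\<^sup>2 / \<sigma>2)))"
    by (simp add: exp_sum[symmetric] sum_negf[symmetric])
  also have "\<dots> \<le> (\<Prod>k=1..n. cgauss_density (v k) (y k))"
  proof (intro prod_mono conjI)
    fix k assume k: "k \<in> {1..n}"
    have pos: "v k > 0" using v[OF k] \<sigma>2_pos by simp
    have "exp (- (pi * v k)) \<le> 1 / (pi * v k)"
    proof -
      have "pi * v k \<le> exp (pi * v k)" using exp_ge_add_one_self[of "pi * v k"] by linarith
      then show ?thesis using pos by (simp add: exp_minus field_simps)
    qed
    moreover have "exp (- ((cmod (y k))\<^sup>2 / \<sigma>2)) \<le> exp (- (cmod (y k))\<^sup>2 / v k)"
      using v[OF k] \<sigma>2_pos by (simp add: frac_le)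
    ultimately have "exp (- ((cmod (y k))\<^sup>2 / \<sigma>2)) * exp (- (pi * v k)) \<le> exp
        (- (cmod (y k))\<^sup>2 / v k) * (1 / (pi * v k))"
      by (intro mult_mono) auto
    then show "exp (- (pi * v k + (cmod (y k))\<^sup>2 / \<sigma>2)) \<le> cgauss_density (v k) (y k)"
      by (simp add: cgauss_density_def mult_exp_exp algebra_simps)
  qed simp
  finally show ?thesis by (simp add: cgauss_vec_density_def)
qed

text \<open>Mixing cannot push the density below the exponential of the averaged exponent. The
  logarithm of a mixture is thus at most quadratic in \<open>y\<close>, with constants given by the
  mean powers.\<close>

lemma
  assumes v: "\<And>k. k \<in> {1..n} \<Longrightarrow> integrable XS (\<lambda>s. v s k)"
    and v_ge: "\<And>s k. k \<in> {1..n} \<Longrightarrow> v s k \<ge> \<sigma>2"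
  shows integrable_cgauss_mixture: "integrable XS (\<lambda>s. cgauss_vec_density {1..n} (v s) y)"
    and cgauss_mixture_ge: "exp (- (\<Sum>k=1..n. pi * (\<integral>s. v s k \<partial>XS) + (cmod (y k))\<^sup>2 / \<sigma>2)) \<le>
      (\<integral>s. cgauss_vec_density {1..n} (v s) y \<partial>XS)"
    and cgauss_mixture_le: "(\<integral>s. cgauss_vec_density {1..n} (v s) y \<partial>XS) \<le> density_bound"
proof -
  have v_pos: "k \<in> {1..n} \<Longrightarrow> v s k > 0" for s k using v_ge[of k s] \<sigma>2_pos by simp
  note bound = cgauss_vec_density_le_bound[of "v s" y for s, OF v_ge]
  have [measurable]: "(\<lambda>s. cgauss_vec_density {1..n} (v s) y) \<in> borel_measurable XS"
    using v by measurable
  show int: "integrable XS (\<lambda>s. cgauss_vec_density {1..n} (v s) y)"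
  proof (rule XS.P.integrable_const_bound[of _ density_bound])
    have "norm (cgauss_vec_density {1..n} (v s) y) \<le> density_bound" for s
      using bound[of s] cgauss_vec_density_pos[of "{1..n}" "v s" y, OF v_pos] by simp
    then show "AE s in XS. norm (cgauss_vec_density {1..n} (v s) y) \<le> density_bound" by simp
  qed measurable
  show "(\<integral>s. cgauss_vec_density {1..n} (v s) y \<partial>XS) \<le> density_bound"
    using bound by (intro XS.P.integral_le_const int) auto
  define U where "U s = (\<Sum>k=1..n. pi * v s k + (cmod (y k))\<^sup>2 / \<sigma>2)" for s
  define m where "m = (\<Sum>k=1..n. pi * (\<integral>s. v s k \<partial>XS) + (cmod (y k))\<^sup>2 / \<sigma>2)"
  have U: "integrable XS U" "(\<integral>s. U s \<partial>XS) = m"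
    unfolding U_def m_def using v by (auto simp: XS.P.prob_space)
  \<comment> \<open>Jensen's inequality by means of the tangent to the exponential at the mean: exp
    (- U) lies above exp (- m) (1 + m - U), whose integral is exp (- m).\<close>
  have "exp (- m) = (\<integral>s. exp (- m) * (1 + m - U s) \<partial>XS)"
    using U by (simp add: XS.P.prob_space)
  also have "\<dots> \<le> (\<integral>s. cgauss_vec_density {1..n} (v s) y \<partial>XS)"
  proof (intro integral_mono int)
    fix s
    have "exp (- m) * (1 + m - U s) \<le> exp (- m) * exp (m - U s)"
      using exp_ge_add_one_self[of "m - U s"] by (intro mult_left_mono) (linarith, simp)
    also have "\<dots> = exp (- U s)" by (simp add: mult_exp_exp)
    also have "\<dots> \<le> cgauss_vec_density {1..n} (v s) y"
      unfolding U_def by (rule cgauss_vec_density_ge_exp[OF v_ge])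
    finally show "exp (- m) * (1 + m - U s) \<le> cgauss_vec_density {1..n} (v s) y" .
  qed (use U in auto)
  finally show "exp (- (\<Sum>k=1..n. pi * (\<integral>s. v s k \<partial>XS) + (cmod (y k))\<^sup>2 / \<sigma>2)) \<le>
      (\<integral>s. cgauss_vec_density {1..n} (v s) y \<partial>XS)" unfolding m_def .
qed

lemma total_power_ge_\<sigma>2: "interference_power s k + (cmod z)\<^sup>2 \<ge> \<sigma>2"
  using power_ge_\<sigma>2(2)[of s k] by (simp add: add_increasing2)

lemma total_power_pos: "interference_power s k + (cmod z)\<^sup>2 > 0"
  using power_pos(2)[of s k] by (simp add: add_pos_nonneg)

lemma conditional_density_pos: "conditional_density a y > 0"
  and output_density_pos: "output_density y > 0"
  and conditional_density_le: "conditional_density a y \<le> density_bound"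
  and output_density_le: "output_density y \<le> density_bound"
proof -
  have v: "integrable XS (\<lambda>s. interference_power s k + (cmod (a k))\<^sup>2)" if "k \<in> {1..n}" for k
    using integrable_power(2)[OF that] by simp
  show "conditional_density a y > 0" "conditional_density a y \<le> density_bound"
    unfolding conditional_density_def
    using less_le_trans[OF exp_gt_zero cgauss_mixture_ge[where v
        = "\<lambda>s k. interference_power s k + (cmod (a k))\<^sup>2" and y = y, OF v total_power_ge_\<sigma>2]]
      cgauss_mixture_le[where v = "\<lambda>s k. interference_power s k + (cmod (a k))\<^sup>2" and y = y, OF v
          total_power_ge_\<sigma>2]
    by blast+
  show "output_density y > 0" "output_density y \<le> density_bound"
    unfolding output_density_def
    using less_le_trans[OF exp_gt_zero cgauss_mixture_ge[where v = received_power and y = y, OF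
        integrable_power(1) power_ge_\<sigma>2(1)]]
      cgauss_mixture_le[where v = received_power and y = y, OF integrable_power(1) power_ge_\<sigma>2(1)]
          by blast+
qed

text \<open>One constant serves both log-densities: the mean interference powers are those needed
  for \<open>conditional_density\<close>, the mean received powers those for
  \<open>output_density\<close>.\<close>

definition log_density_bound :: real where
  "log_density_bound = \<bar>ln density_bound\<bar>
      + (\<Sum>k=1..n. pi * ((\<integral>s. interference_power s k \<partial>XS) + (\<integral>s. received_power s k \<partial>XS)))"

lemma abs_ln_conditional_density_le:
  "\<bar>ln (conditional_density a y)\<bar> \<le> log_density_bound
      + (\<Sum>k=1..n. pi * (cmod (a k))\<^sup>2 + (cmod (y k))\<^sup>2 / \<sigma>2)"
proof -
  have nonneg: "(\<integral>s. interference_power s k \<partial>XS) \<ge> 0" "(\<integral>s. received_power s k \<partial>XS) \<ge> 0" for k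
    by (intro Bochner_Integration.integral_nonneg less_imp_le power_pos)+
  have eq: "(\<integral>s. interference_power s k + (cmod (a k))\<^sup>2 \<partial>XS) = (\<integral>s. interference_power s k \<partial>XS)
      + (cmod (a k))\<^sup>2" if "k \<in> {1..n}" for k
    using integrable_power(2)[OF that] by (simp add: XS.P.prob_space)
  let ?u = "\<Sum>k=1..n. pi * ((\<integral>s. interference_power s k \<partial>XS) + (cmod (a k))\<^sup>2) + (cmod (y k))\<^sup>2 / \<sigma>2"
  have v: "integrable XS (\<lambda>s. interference_power s k + (cmod (a k))\<^sup>2)" if "k \<in> {1..n}" for k
    using integrable_power(2)[OF that] by simp
  have "?u = (\<Sum>k=1..n. pi * (\<integral>s. interference_power s k + (cmod (a k))\<^sup>2 \<partial>XS) + (cmod (y k))\<^sup>2 / \<sigma>2)"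
    by (intro sum.cong refl) (simp only: eq)
  then have "exp (- ?u) \<le> conditional_density a y"
    unfolding conditional_density_def
    using cgauss_mixture_ge[where v = "\<lambda>s k. interference_power s k + (cmod (a k))\<^sup>2" and y = y, OF
        v total_power_ge_\<sigma>2]
    by (simp only:)
  then have "\<bar>ln (conditional_density a y)\<bar> \<le> \<bar>?u\<bar> + \<bar>ln density_bound\<bar>"
    by (rule abs_ln_le) (rule conditional_density_le)
  also have "\<bar>?u\<bar> = ?u"
    using nonneg \<sigma>2_pos by (intro abs_of_nonneg sum_nonneg add_nonneg_nonneg mult_nonneg_nonneg
        divide_nonneg_nonneg) auto
  finally have bound: "\<bar>ln (conditional_density a y)\<bar> \<le> ?u + \<bar>ln density_bound\<bar>" .
  show ?thesis
  proof -
    have "0 \<le> (\<Sum>k=1..n. pi * (\<integral>s. received_power s k \<partial>XS))"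
      using nonneg(2) by (intro sum_nonneg mult_nonneg_nonneg) auto
    with bound show ?thesis
      unfolding log_density_bound_def sum.distrib distrib_left by linarith
  qed
qed

lemma abs_ln_output_density_le:
  "\<bar>ln (output_density y)\<bar> \<le> log_density_bound + (\<Sum>k=1..n. (cmod (y k))\<^sup>2 / \<sigma>2)"
proof -
  have nonneg: "(\<integral>s. interference_power s k \<partial>XS) \<ge> 0" "(\<integral>s. received_power s k \<partial>XS) \<ge> 0" for k
    by (intro Bochner_Integration.integral_nonneg less_imp_le power_pos)+
  let ?u = "\<Sum>k=1..n. pi * (\<integral>s. received_power s k \<partial>XS) + (cmod (y k))\<^sup>2 / \<sigma>2"
  have "exp (- ?u) \<le> output_density y"
    unfolding output_density_def
    by (rule cgauss_mixture_ge[where v = received_power, OF integrable_power(1) power_ge_\<sigma>2(1)])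
  then have "\<bar>ln (output_density y)\<bar> \<le> \<bar>?u\<bar> + \<bar>ln density_bound\<bar>"
    by (rule abs_ln_le) (rule output_density_le)
  also have "\<bar>?u\<bar> = ?u"
    using nonneg \<sigma>2_pos by (intro abs_of_nonneg sum_nonneg add_nonneg_nonneg mult_nonneg_nonneg
        divide_nonneg_nonneg) auto
  finally have bound: "\<bar>ln (output_density y)\<bar> \<le> ?u + \<bar>ln density_bound\<bar>" .
  show ?thesis
  proof -
    have "0 \<le> (\<Sum>k=1..n. pi * (\<integral>s. interference_power s k \<partial>XS))"
      using nonneg(1) by (intro sum_nonneg mult_nonneg_nonneg) auto
    with bound show ?thesis
      unfolding log_density_bound_def sum.distrib distrib_left by linarith
  qed
qed

lemma measurable_conditional_density[measurable (raw)]: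
  assumes [measurable]: "a \<in> measurable M Q" "y \<in> measurable M (block_space n)"
  shows "(\<lambda>\<omega>. conditional_density (a \<omega>) (y \<omega>)) \<in> borel_measurable M"
proof -
  have [measurable]: "(\<lambda>(\<omega>, s). cgauss_vec_density {1..n}
      (\<lambda>k. interference_power s k + (cmod (a \<omega> k))\<^sup>2) (y \<omega>)) \<in> borel_measurable (M \<Otimes>\<^sub>M XS)"
  proof -
    have [measurable]: "(\<lambda>\<omega>. a \<omega> k) \<in> borel_measurable M" if "k \<in> {1..n}" for k
      using measurable_block_component[of a M k] assms(1) that
          by (simp cong: measurable_cong_sets add: sets_Q)
    show ?thesis unfolding case_prod_unfold by measurable
  qed
  show ?thesis unfolding conditional_density_def by measurable
qed

lemma measurable_output_density[measurable (raw)]: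
  assumes [measurable]: "y \<in> measurable M (block_space n)"
  shows "(\<lambda>\<omega>. output_density (y \<omega>)) \<in> borel_measurable M"
proof -
  have [measurable]: "(\<lambda>(\<omega>, s). cgauss_vec_density {1..n} (received_power s) (y \<omega>))
      \<in> borel_measurable (M \<Otimes>\<^sub>M XS)"
    unfolding case_prod_unfold by measurable
  show ?thesis unfolding output_density_def by measurable
qed

section \<open>Joint and marginal laws through the mixture densities\<close>

lemma nn_integral_conditional_mixture:
  "(\<integral>\<^sup>+ s. ennreal (cgauss_vec_density {1..n} (\<lambda>k. interference_power s k + (cmod (a k))\<^sup>2) y) \<partial>XS)
      = ennreal (conditional_density a y)"
  unfolding conditional_density_def
  using integrable_power(2) total_power_ge_\<sigma>2 total_power_pos
  by (intro nn_integral_eq_integral integrable_cgauss_mixture AE_I2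
      less_imp_le[OF cgauss_vec_density_pos]) auto

lemma nn_integral_output_mixture:
  "(\<integral>\<^sup>+ s. ennreal (cgauss_vec_density {1..n} (received_power s) y) \<partial>XS) = ennreal (output_density y)"
  unfolding output_density_def
  using integrable_power(1) power_ge_\<sigma>2(1) power_pos(1)
  by (intro nn_integral_eq_integral integrable_cgauss_mixture AE_I2
      less_imp_le[OF cgauss_vec_density_pos]) auto

lemma nn_integral_cgauss_vec_density:
  assumes "\<And>k. v k > 0"
  shows "(\<integral>\<^sup>+ y. ennreal (cgauss_vec_density {1..n} v y) \<partial>L) = 1"
proof -
  interpret G: prob_space "PiM {1..n} (\<lambda>k. complex_gaussian (v k))"
    by (rule prob_space_PiM_complex_gaussian) fact
  show ?thesis
    using nn_integral_PiM_complex_gaussian[of "{1..n}" v "\<lambda>_. 1"] assms G.emeasure_space_1 by simp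
qed

text \<open>The block of the transmitter is split off from the sequence of all blocks; the remaining
  ones again have law \<open>XS\<close> and take the role of the interferers.\<close>

lemma nn_integral_joint:
  assumes f[measurable]: "f \<in> borel_measurable (block_space n \<Otimes>\<^sub>M block_space n)"
  shows "(\<integral>\<^sup>+ \<omega>. f (channel_input \<omega>, channel_output n \<omega>) \<partial>channel_space \<alpha> \<sigma>2 n Q) =
    (\<integral>\<^sup>+ a. \<integral>\<^sup>+ s. \<integral>\<^sup>+ y. ennreal (cgauss_vec_density {1..n}
        (\<lambda>k. interference_power s k + (cmod (a k))\<^sup>2) y) * f (a, y) \<partial>L \<partial>XS \<partial>Q)"
proof -
  have "(\<integral>\<^sup>+ \<omega>. f (channel_input \<omega>, channel_output n \<omega>) \<partial>channel_space \<alpha> \<sigma>2 n Q) =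
    (\<integral>\<^sup>+ a. \<integral>\<^sup>+ s. \<integral>\<^sup>+ y. ennreal (cgauss_vec_density {1..n} (received_power (case_nat a s)) y)
        * f (case_nat a s 0, y) \<partial>L \<partial>XS \<partial>Q)"
    unfolding nn_integral_channel[OF f] by (rule nn_integral_XS_case_nat) measurable
  also have "\<dots> = (\<integral>\<^sup>+ a. \<integral>\<^sup>+ s. \<integral>\<^sup>+ y. ennreal
      (cgauss_vec_density {1..n} (\<lambda>k. interference_power s k + (cmod (a k))\<^sup>2) y) * f (a, y) \<partial>L \<partial>XS \<partial>Q)"
  proof (rule nn_integral_cong, rule nn_integral_cong_AE)
    fix a
    show "AE s in XS. (\<integral>\<^sup>+ y. ennreal (cgauss_vec_density {1..n} (received_power (case_nat a s)) y)
        * f (case_nat a s 0, y) \<partial>L) =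
       (\<integral>\<^sup>+ y. ennreal (cgauss_vec_density {1..n} (\<lambda>k. interference_power s k + (cmod (a k))\<^sup>2) y)
           * f (a, y) \<partial>L)"
      using AE_finite_power by eventually_elim (simp add: received_power_case_nat cgauss_vec_density_def)
  qed
  finally show ?thesis .
qed

lemma nn_integral_joint_density:
  assumes f[measurable]: "f \<in> borel_measurable (block_space n \<Otimes>\<^sub>M block_space n)"
  shows "(\<integral>\<^sup>+ \<omega>. f (channel_input \<omega>, channel_output n \<omega>) \<partial>channel_space \<alpha> \<sigma>2 n Q) =
    (\<integral>\<^sup>+ p. ennreal (conditional_density (fst p) (snd p)) * f p \<partial>(Q \<Otimes>\<^sub>M L))"
proof -
  have "(\<integral>\<^sup>+ s. \<integral>\<^sup>+ y. ennreal (cgauss_vec_density {1..n}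
      (\<lambda>k. interference_power s k + (cmod (a k))\<^sup>2) y) * f (a, y) \<partial>L \<partial>XS) =
     (\<integral>\<^sup>+ y. ennreal (conditional_density a y) * f (a, y) \<partial>L)" if "a \<in> space Q" for a
  proof -
    have [measurable]: "a \<in> space (block_space n)"
      using that sets_eq_imp_space_eq[OF sets_Q] by simp
    have "(\<integral>\<^sup>+ s. \<integral>\<^sup>+ y. ennreal (cgauss_vec_density {1..n}
        (\<lambda>k. interference_power s k + (cmod (a k))\<^sup>2) y) * f (a, y) \<partial>L \<partial>XS) =
      (\<integral>\<^sup>+ y. \<integral>\<^sup>+ s. ennreal (cgauss_vec_density {1..n}
          (\<lambda>k. interference_power s k + (cmod (a k))\<^sup>2) y) * f (a, y) \<partial>XS \<partial>L)"
      by (intro pair_sigma_finite.Fubini' pair_sigma_finite.intro XS.P.sigma_finite_measure_axioms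
          L.sigma_finite_measure_axioms) measurable
    also have "\<dots> = (\<integral>\<^sup>+ y. ennreal (conditional_density a y) * f (a, y) \<partial>L)"
      unfolding nn_integral_conditional_mixture[symmetric]
      by (intro nn_integral_cong nn_integral_multc) measurable
    finally show ?thesis .
  qed
  then have "(\<integral>\<^sup>+ \<omega>. f (channel_input \<omega>, channel_output n \<omega>) \<partial>channel_space \<alpha> \<sigma>2 n Q) =
     (\<integral>\<^sup>+ a. \<integral>\<^sup>+ y. ennreal (conditional_density a y) * f (a, y) \<partial>L \<partial>Q)"
    unfolding nn_integral_joint[OF f] by (intro nn_integral_cong) auto
  also have "\<dots> = (\<integral>\<^sup>+ p. ennreal (conditional_density (fst p) (snd p)) * f p \<partial>(Q \<Otimes>\<^sub>M L))"
    by (subst L.nn_integral_fst[symmetric]) auto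
  finally show ?thesis .
qed

lemma nn_integral_output:
  assumes f[measurable]: "f \<in> borel_measurable (block_space n)"
  shows "(\<integral>\<^sup>+ \<omega>. f (channel_output n \<omega>) \<partial>channel_space \<alpha> \<sigma>2 n Q) =
    (\<integral>\<^sup>+ s. \<integral>\<^sup>+ y. ennreal (cgauss_vec_density {1..n} (received_power s) y) * f y \<partial>L \<partial>XS)"
  using nn_integral_channel[of "\<lambda>p. f (snd p)"] by simp

lemma nn_integral_output_density:
  assumes f[measurable]: "f \<in> borel_measurable (block_space n)"
  shows "(\<integral>\<^sup>+ \<omega>. f (channel_output n \<omega>) \<partial>channel_space \<alpha> \<sigma>2 n Q) =
    (\<integral>\<^sup>+ y. ennreal (output_density y) * f y \<partial>L)"
proof -
  have "(\<integral>\<^sup>+ s. \<integral>\<^sup>+ y. ennreal (cgauss_vec_density {1..n} (received_power s) y) * f y \<partial>L \<partial>XS) =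
      (\<integral>\<^sup>+ y. \<integral>\<^sup>+ s. ennreal (cgauss_vec_density {1..n} (received_power s) y) * f y \<partial>XS \<partial>L)"
    by (intro pair_sigma_finite.Fubini' pair_sigma_finite.intro XS.P.sigma_finite_measure_axioms
        L.sigma_finite_measure_axioms) measurable
  also have "\<dots> = (\<integral>\<^sup>+ y. ennreal (output_density y) * f y \<partial>L)"
    unfolding nn_integral_output_mixture[symmetric]
    by (intro nn_integral_cong nn_integral_multc) measurable
  finally show ?thesis unfolding nn_integral_output[OF f] .
qed

lemma nn_integral_input:
  assumes f[measurable]: "f \<in> borel_measurable (block_space n)"
  shows "(\<integral>\<^sup>+ \<omega>. f (channel_input \<omega>) \<partial>channel_space \<alpha> \<sigma>2 n Q) = (\<integral>\<^sup>+ a. f a \<partial>Q)"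
proof -
  have "(\<integral>\<^sup>+ \<omega>. f (channel_input \<omega>) \<partial>channel_space \<alpha> \<sigma>2 n Q) =
    (\<integral>\<^sup>+ x. \<integral>\<^sup>+ y. ennreal (cgauss_vec_density {1..n} (received_power x) y) * f (x 0) \<partial>L \<partial>XS)"
    using nn_integral_channel[of "\<lambda>p. f (fst p)"] by simp
  also have "\<dots> = (\<integral>\<^sup>+ x. f (x 0) \<partial>XS)"
    using power_pos(1) by (simp add: nn_integral_multc nn_integral_cgauss_vec_density)
  also have "\<dots> = (\<integral>\<^sup>+ a. f a \<partial>Q)" by (rule nn_integral_XS_component) measurable
  finally show ?thesis .
qed

section \<open>Mutual information\<close>

abbreviation "CH \<equiv> channel_space \<alpha> \<sigma>2 n Q"
abbreviation "BS \<equiv> block_space n"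

sublocale CH: prob_space CH
  unfolding channel_space_eq by (rule XHZ.P.prob_space_axioms)

text \<open>The second moment of an output symbol is its mean received power. Both log-densities are
  bounded by these energies, which makes them integrable.\<close>

lemma integrable_channel_energy:
  assumes k: "k \<in> {1..n}"
  shows "integrable CH (\<lambda>\<omega>. (cmod (channel_input \<omega> k))\<^sup>2)"
    and "integrable CH (\<lambda>\<omega>. (cmod (channel_output n \<omega> k))\<^sup>2)"
proof -
  have energy: "(\<lambda>y. ennreal ((cmod (y k))\<^sup>2)) \<in> borel_measurable BS"
    using k by measurable
  show "integrable CH (\<lambda>\<omega>. (cmod (channel_input \<omega> k))\<^sup>2)"
    using k symbol_energy_finite[OF k] nn_integral_input[OF energy]
    by (intro integrableI_bounded) auto
  have "(\<integral>\<^sup>+ \<omega>. ennreal ((cmod (channel_output n \<omega> k))\<^sup>2) \<partial>CH)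
      = (\<integral>\<^sup>+ s. ennreal (received_power s k) \<partial>XS)"
    using nn_integral_output[OF energy] cgauss_vec_second_moment[OF _ _ k] power_pos(1) by simp
  also have "\<dots> < \<infinity>"
    using nn_integral_eq_integral[OF integrable_power(1)[OF k]] power_pos(1) by (simp add: less_imp_le)
  finally show "integrable CH (\<lambda>\<omega>. (cmod (channel_output n \<omega> k))\<^sup>2)"
    using k by (intro integrableI_bounded) auto
qed

lemma measurable_channel_input_Q: "channel_input \<in> measurable CH Q"
  using measurable_channel_input by (simp cong: measurable_cong_sets add: sets_Q)

lemma integrable_ln_conditional_density:
  "integrable CH (\<lambda>\<omega>. ln (conditional_density (channel_input \<omega>) (channel_output n \<omega>)))"
proof (rule Bochner_Integration.integrable_bound)
  let ?b = "\<lambda>\<omega>. log_density_bound + (\<Sum>k=1..n. pi * (cmod (channel_input \<omega> k))\<^sup>2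
      + (cmod (channel_output n \<omega> k))\<^sup>2 / \<sigma>2)"
  show "integrable CH ?b"
    by (intro Bochner_Integration.integrable_add Bochner_Integration.integrable_sum CH.integrable_const
      integrable_mult_right integrable_divide integrable_channel_energy)
  note measurable_channel_input_Q[measurable]
  show "(\<lambda>\<omega>. ln (conditional_density (channel_input \<omega>) (channel_output n \<omega>))) \<in> borel_measurable CH"
    by measurable
  show "AE \<omega> in CH. norm (ln (conditional_density (channel_input \<omega>) (channel_output n \<omega>))) \<le> norm (?b \<omega>)"
  proof (rule AE_I2)
    fix \<omega>
    show "norm (ln (conditional_density (channel_input \<omega>) (channel_output n \<omega>))) \<le> norm (?b \<omega>)"
      unfolding real_norm_def using abs_ln_conditional_density_le[of "channel_input \<omega>"
          "channel_output n \<omega>"] by linarith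
  qed
qed

lemma integrable_ln_output_density:
  "integrable CH (\<lambda>\<omega>. ln (output_density (channel_output n \<omega>)))"
proof (rule Bochner_Integration.integrable_bound)
  let ?b = "\<lambda>\<omega>. log_density_bound + (\<Sum>k=1..n. (cmod (channel_output n \<omega> k))\<^sup>2 / \<sigma>2)"
  show "integrable CH ?b"
    by (intro Bochner_Integration.integrable_add Bochner_Integration.integrable_sum CH.integrable_const
      integrable_mult_right integrable_divide integrable_channel_energy)
  show "(\<lambda>\<omega>. ln (output_density (channel_output n \<omega>))) \<in> borel_measurable CH"
    by measurable
  show "AE \<omega> in CH. norm (ln (output_density (channel_output n \<omega>))) \<le> norm (?b \<omega>)"
  proof (rule AE_I2)
    fix \<omega>
    show "norm (ln (output_density (channel_output n \<omega>))) \<le> norm (?b \<omega>)"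
      unfolding real_norm_def using abs_ln_output_density_le[of "channel_output n \<omega>"] by linarith
  qed
qed

lemma distr_channel_input: "distr CH BS channel_input = Q"
proof (rule measure_eqI)
  fix A assume "A \<in> sets (distr CH BS channel_input)"
  then have [measurable]: "A \<in> sets BS" by simp
  have "emeasure (distr CH BS channel_input) A = (\<integral>\<^sup>+ a. indicator A a \<partial>distr CH BS channel_input)"
    by simp
  also have "\<dots> = (\<integral>\<^sup>+ \<omega>. indicator A (channel_input \<omega>) \<partial>CH)"
    by (rule nn_integral_distr) measurable
  also have "\<dots> = (\<integral>\<^sup>+ a. indicator A a \<partial>Q)"
    by (rule nn_integral_input) measurable
  also have "\<dots> = emeasure Q A"
    by (rule nn_integral_indicator) (simp add: sets_Q)
  finally show "emeasure (distr CH BS channel_input) A = emeasure Q A" .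
qed (simp add: sets_Q)

lemma distr_channel_output: "distr CH BS (channel_output n) = density L (\<lambda>y. ennreal (output_density y))"
proof (rule measure_eqI)
  fix A assume "A \<in> sets (distr CH BS (channel_output n))"
  then have [measurable]: "A \<in> sets BS" by simp
  have "emeasure (distr CH BS (channel_output n)) A
      = (\<integral>\<^sup>+ a. indicator A a \<partial>distr CH BS (channel_output n))"
    by simp
  also have "\<dots> = (\<integral>\<^sup>+ \<omega>. indicator A (channel_output n \<omega>) \<partial>CH)"
    by (rule nn_integral_distr) measurable
  also have "\<dots> = (\<integral>\<^sup>+ y. ennreal (output_density y) * indicator A y \<partial>L)"
    by (rule nn_integral_output_density) measurable
  also have "\<dots> = emeasure (density L (\<lambda>y. ennreal (output_density y))) A"
    by (subst emeasure_density) auto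
  finally show "emeasure (distr CH BS (channel_output n)) A = emeasure
      (density L (\<lambda>y. ennreal (output_density y))) A" .
qed (simp add: sets_L)

lemma distr_channel_joint:
  "distr CH (BS \<Otimes>\<^sub>M BS) (\<lambda>\<omega>. (channel_input \<omega>, channel_output n \<omega>)) =
    density (Q \<Otimes>\<^sub>M L) (\<lambda>p. ennreal (conditional_density (fst p) (snd p)))"
    (is "?J = ?D")
proof (rule measure_eqI)
  have sets_QL: "sets (Q \<Otimes>\<^sub>M L) = sets (BS \<Otimes>\<^sub>M BS)"
    by (intro sets_pair_measure_cong sets_Q sets_L)
  show "sets ?J = sets ?D" by (simp only: sets_distr sets_density sets_QL)
  fix A assume "A \<in> sets ?J"
  then have A[measurable]: "A \<in> sets (BS \<Otimes>\<^sub>M BS)" by simp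
  have "emeasure ?J A = (\<integral>\<^sup>+ a. indicator A a \<partial>?J)"
    by simp
  also have "\<dots> = (\<integral>\<^sup>+ \<omega>. indicator A (channel_input \<omega>, channel_output n \<omega>) \<partial>CH)"
    by (rule nn_integral_distr) measurable
  also have "\<dots> = (\<integral>\<^sup>+ p. ennreal (conditional_density (fst p) (snd p)) * indicator A p \<partial>(Q \<Otimes>\<^sub>M L))"
    by (rule nn_integral_joint_density) measurable
  also have "\<dots> = emeasure ?D A"
    using A by (subst emeasure_density) (auto simp: sets_QL)
  finally show "emeasure ?J A = emeasure ?D A" .
qed

text \<open>The information is infinite by definition unless absolute continuity and integrability
  hold, so both are established. Positivity of the densities makes their quotient the density of the
  joint law with respect to the product of the marginals, and separate integrability of the two
  logarithms splits the integral.\<close>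

lemma mutual_information_eq:
  "mutual_information_nats CH BS BS channel_input (channel_output n) =
    ereal ((\<integral>\<omega>. ln (conditional_density (channel_input \<omega>) (channel_output n \<omega>)) \<partial>CH) -
      (\<integral>\<omega>. ln (output_density (channel_output n \<omega>)) \<partial>CH))"
proof -
  define marg where "marg = distr CH BS channel_input \<Otimes>\<^sub>M distr CH BS (channel_output n)"
  define joint where "joint = distr CH (BS \<Otimes>\<^sub>M BS) (\<lambda>\<omega>. (channel_input \<omega>, channel_output n \<omega>))"
  define r where "r p = conditional_density (fst p) (snd p) / output_density (snd p)" for p
  interpret I: prob_space "distr CH BS channel_input" by (rule CH.prob_space_distr) measurable
  interpret O: prob_space "distr CH BS (channel_output n)" by (rule CH.prob_space_distr) measurable
  interpret IO: pair_prob_space "distr CH BS channel_input" "distr CH BS (channel_output n)" ..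
  have sets_QL[measurable_cong]: "sets (Q \<Otimes>\<^sub>M L) = sets (BS \<Otimes>\<^sub>M BS)"
    by (intro sets_pair_measure_cong sets_Q sets_L)
  have f0[measurable]: "(\<lambda>p. conditional_density (fst p) (snd p)) \<in> borel_measurable (Q \<Otimes>\<^sub>M L)"
    by measurable
  have f[measurable]: "(\<lambda>p. output_density (snd p)) \<in> borel_measurable (Q \<Otimes>\<^sub>M L)"
    by measurable
  have r[measurable]: "r \<in> borel_measurable (Q \<Otimes>\<^sub>M L)"
    unfolding r_def by measurable
  have "marg = density Q (\<lambda>_. 1) \<Otimes>\<^sub>M density L (\<lambda>y. ennreal (output_density y))"
    unfolding marg_def distr_channel_input distr_channel_output by (simp add: density_1)
  also have "\<dots> = density (Q \<Otimes>\<^sub>M L) (\<lambda>(a, y). 1 * ennreal (output_density y))"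
    using O.sigma_finite_measure_axioms unfolding distr_channel_output
    by (intro pair_measure_density) (auto intro: L.sigma_finite_measure_axioms)
  finally have marg: "marg = density (Q \<Otimes>\<^sub>M L) (\<lambda>p. ennreal (output_density (snd p)))"
    by (simp add: case_prod_unfold)
  have sets_marg: "sets marg = sets (BS \<Otimes>\<^sub>M BS)" "sets joint = sets (BS \<Otimes>\<^sub>M BS)"
    unfolding marg_def joint_def by (simp_all cong: sets_pair_measure_cong)
  have r_marg[measurable]: "r \<in> borel_measurable marg"
    using r by (simp cong: measurable_cong_sets add: sets_marg sets_QL)
  have joint: "joint = density marg (\<lambda>p. ennreal (r p))"
    unfolding joint_def distr_channel_joint marg r_def
    using conditional_density_pos output_density_pos
    by (subst density_density_eq) (auto simp: ennreal_mult[symmetric] less_imp_le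
        less_imp_neq[symmetric])
  have ac: "absolutely_continuous marg joint"
    unfolding joint by (rule absolutely_continuousI_density) measurable
  \<comment> \<open>Derivatives are unique only up to null sets of the product of the marginals;
    absolute continuity makes these null for the joint law too.\<close>
  have "AE p in marg. ennreal (r p) = RN_deriv marg joint p"
    unfolding marg_def
    by (rule IO.P.RN_deriv_unique) (unfold marg_def[symmetric], auto simp: joint)
  then have "AE p in joint. ennreal (r p) = RN_deriv marg joint p"
    by (rule absolutely_continuous_AE[OF _ ac, rotated]) (simp only: sets_marg)
  then have ed: "AE p in joint. entropy_density (exp 1) marg joint p = ln
      (conditional_density (fst p) (snd p)) - ln (output_density (snd p))"
  proof eventually_elim
    case (elim p)
    have "r p \<ge> 0" unfolding r_def using conditional_density_pos output_density_pos
        by (simp add: less_imp_le)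
    then show ?case
      unfolding entropy_density_def comp_def elim[symmetric]
      using conditional_density_pos output_density_pos
          by (simp add: log_def r_def ln_div less_imp_neq[symmetric])
  qed
  note measurable_channel_input_Q[measurable]
  have pair[measurable]: "(\<lambda>\<omega>. (channel_input \<omega>, channel_output n \<omega>)) \<in> measurable CH (BS \<Otimes>\<^sub>M BS)"
    by measurable
  have g[measurable]: "(\<lambda>p. ln (conditional_density (fst p) (snd p)) - ln (output_density (snd p)))
      \<in> borel_measurable (BS \<Otimes>\<^sub>M BS)"
    using f0 f by (simp cong: measurable_cong_sets add: sets_QL)
  have g_joint: "(\<lambda>p. ln (conditional_density (fst p) (snd p)) - ln (output_density (snd p)))
      \<in> borel_measurable joint"
    using g by (simp cong: measurable_cong_sets add: sets_marg)
  have ed_joint: "entropy_density (exp 1) marg joint \<in> borel_measurable joint"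
    using measurable_entropy_density[of "exp 1" marg joint]
        by (simp cong: measurable_cong_sets add: sets_marg)
  have int: "integrable joint (entropy_density (exp 1) marg joint)"
    unfolding integrable_cong_AE[OF ed_joint g_joint ed] unfolding joint_def
        integrable_distr_eq[OF pair g]
    using integrable_ln_conditional_density integrable_ln_output_density by simp
  have "CH.mutual_information (exp 1) BS BS channel_input (channel_output n)
      = (\<integral>p. entropy_density (exp 1) marg joint p \<partial>joint)"
    unfolding CH.mutual_information_def KL_divergence_def marg_def joint_def ..
  also have "\<dots> = (\<integral>\<omega>. ln (conditional_density (channel_input \<omega>) (channel_output n \<omega>)) - ln
      (output_density (channel_output n \<omega>)) \<partial>CH)"
    unfolding integral_cong_AE[OF ed_joint g_joint ed] unfolding joint_def integral_distr[OF pair g]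
        by simp
  finally show ?thesis
    using ac int integrable_ln_conditional_density integrable_ln_output_density
    unfolding mutual_information_nats_def Let_def marg_def[symmetric] joint_def[symmetric] by simp
qed

section \<open>Comparing the output with the interference\<close>

text \<open>\<open>Omega\<close> carries a coupling: in a sample \<open>(a, w, s, g)\<close>, the block \<open>a\<close> is sent with fading \<open>w\<close>,
  and one and the same noise \<open>g\<close> drives both the interference \<open>scaled (interference_power s) g\<close> and
  the independent channel output \<open>scaled (received_power s) g\<close>, for which \<open>s\<close> is read as the
  blocks of all users.\<close>

abbreviation "Omega \<equiv> Q \<Otimes>\<^sub>M (W \<Otimes>\<^sub>M (XS \<Otimes>\<^sub>M W))"

sublocale XW: pair_prob_space XS W ..
sublocale WXW: pair_prob_space W "XS \<Otimes>\<^sub>M W" ..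
sublocale Omega: pair_prob_space Q "W \<Otimes>\<^sub>M (XS \<Otimes>\<^sub>M W)" ..

definition faded :: "(nat \<Rightarrow> complex) \<Rightarrow> (nat \<Rightarrow> complex) \<Rightarrow> (nat \<Rightarrow> complex) \<Rightarrow> nat \<Rightarrow> complex" where
  "faded a w y = (\<lambda>k\<in>{1..n}. w k * a k + y k)"

text \<open>The argument is a variance, hence the square root: \<open>scaled (\<lambda>_. M)\<close>
  multiplies by sqrt M.\<close>

definition scaled :: "(nat \<Rightarrow> real) \<Rightarrow> (nat \<Rightarrow> complex) \<Rightarrow> nat \<Rightarrow> complex" where
  "scaled v g = (\<lambda>k\<in>{1..n}. of_real (sqrt (v k)) * g k)"

lemma measurable_faded[measurable (raw)]:
  assumes [measurable]: "a \<in> measurable M BS" "w \<in> measurable M BS" "y \<in> measurable M BS"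
  shows "(\<lambda>\<omega>. faded (a \<omega>) (w \<omega>) (y \<omega>)) \<in> measurable M BS"
  unfolding faded_def by measurable

lemma measurable_scaled[measurable (raw)]:
  assumes [measurable]: "\<And>k. k \<in> {1..n} \<Longrightarrow> (\<lambda>\<omega>. v \<omega> k) \<in> borel_measurable M" "g \<in> measurable M BS"
  shows "(\<lambda>\<omega>. scaled (v \<omega>) (g \<omega>)) \<in> measurable M BS"
  unfolding scaled_def by measurable

lemma nn_integral_Omega:
  assumes [measurable]: "f \<in> borel_measurable Omega"
  shows "(\<integral>\<^sup>+ \<omega>. f \<omega> \<partial>Omega) = (\<integral>\<^sup>+ a. \<integral>\<^sup>+ w. \<integral>\<^sup>+ s. \<integral>\<^sup>+ g. f (a, w, s, g) \<partial>W \<partial>XS \<partial>W \<partial>Q)"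
proof -
  have "(\<integral>\<^sup>+ \<omega>. f \<omega> \<partial>Omega) = (\<integral>\<^sup>+ a. \<integral>\<^sup>+ p. f (a, p) \<partial>(W \<Otimes>\<^sub>M (XS \<Otimes>\<^sub>M W)) \<partial>Q)"
    by (intro WXW.P.nn_integral_fst[symmetric]) measurable
  also have "\<dots> = (\<integral>\<^sup>+ a. \<integral>\<^sup>+ w. \<integral>\<^sup>+ q. f (a, w, q) \<partial>(XS \<Otimes>\<^sub>M W) \<partial>W \<partial>Q)"
    by (intro nn_integral_cong XW.P.nn_integral_fst[symmetric]) measurable
  also have "\<dots> = (\<integral>\<^sup>+ a. \<integral>\<^sup>+ w. \<integral>\<^sup>+ s. \<integral>\<^sup>+ g. f (a, w, s, g) \<partial>W \<partial>XS \<partial>W \<partial>Q)"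
    by (intro nn_integral_cong W.nn_integral_fst[symmetric]) measurable
  finally show ?thesis .
qed

lemma nn_integral_scaled:
  assumes v: "\<And>k. v k > 0" and f[measurable]: "f \<in> borel_measurable BS"
  shows "(\<integral>\<^sup>+ g. f (scaled v g) \<partial>W) = (\<integral>\<^sup>+ y. ennreal (cgauss_vec_density {1..n} v y) * f y \<partial>L)"
proof -
  have "(\<integral>\<^sup>+ g. f (scaled v g) \<partial>W) = (\<integral>\<^sup>+ y. f y \<partial>PiM {1..n} (\<lambda>k. complex_gaussian ((sqrt (v k))\<^sup>2)))"
    unfolding scaled_def using v by (intro nn_integral_PiM_cgauss_scale) auto
  also have "\<dots> = (\<integral>\<^sup>+ y. f y \<partial>PiM {1..n} (\<lambda>k. complex_gaussian (v k)))"
    using v by (simp add: less_imp_le)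
  also have "\<dots> = (\<integral>\<^sup>+ y. ennreal (cgauss_vec_density {1..n} v y) * f y \<partial>L)"
    using v by (intro nn_integral_PiM_complex_gaussian) auto
  finally show ?thesis .
qed

text \<open>Given \<open>a\<close> and \<open>s\<close>, integrating out the fading \<open>w\<close>
  raises the variances from \<open>interference_power s k\<close> to those of the output given all
  blocks. So \<open>a\<close> and the faded point have the joint law of channel input and
  output.\<close>

lemma nn_integral_Omega_joint:
  assumes f[measurable]: "f \<in> borel_measurable (BS \<Otimes>\<^sub>M BS)"
  shows "(\<integral>\<^sup>+ (a, w, s, g). f (a, faded a w (scaled (interference_power s) g)) \<partial>Omega) =
    (\<integral>\<^sup>+ \<omega>. f (channel_input \<omega>, channel_output n \<omega>) \<partial>CH)"
proof -
  have "(\<integral>\<^sup>+ (a, w, s, g). f (a, faded a w (scaled (interference_power s) g)) \<partial>Omega) =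
    (\<integral>\<^sup>+ a. \<integral>\<^sup>+ w. \<integral>\<^sup>+ s. \<integral>\<^sup>+ g. f (a, faded a w (scaled (interference_power s) g)) \<partial>W \<partial>XS \<partial>W \<partial>Q)"
    by (subst nn_integral_Omega) (auto simp: case_prod_unfold)
  also have "\<dots> = (\<integral>\<^sup>+ a. \<integral>\<^sup>+ s. \<integral>\<^sup>+ y. ennreal
      (cgauss_vec_density {1..n} (\<lambda>k. interference_power s k + (cmod (a k))\<^sup>2) y) * f (a, y) \<partial>L \<partial>XS \<partial>Q)"
  proof (rule nn_integral_cong)
    fix a assume "a \<in> space Q"
    then have a[measurable]: "a \<in> space BS"
      using sets_eq_imp_space_eq[OF sets_Q] by simp
    let ?k = "\<lambda>w s y. cgauss_vec_density {1..n} (interference_power s) (\<lambda>k. y k - w k * a k)"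
    have "(\<integral>\<^sup>+ g. f (a, faded a w (scaled (interference_power s) g)) \<partial>W)
        = (\<integral>\<^sup>+ y. ennreal (?k w s y) * f (a, y) \<partial>L)"
      if "w \<in> space W" for w s
    proof -
      have w[measurable]: "w \<in> space BS"
        using that sets_eq_imp_space_eq[OF sets_W] by simp
      have "(\<integral>\<^sup>+ g. f (a, faded a w (scaled (interference_power s) g)) \<partial>W) =
          (\<integral>\<^sup>+ y. ennreal (cgauss_vec_density {1..n} (interference_power s) y) * f (a, faded a w y) \<partial>L)"
        by (rule nn_integral_scaled[OF power_pos(2), where f = "\<lambda>y. f (a, faded a w y)"]) measurable
      \<comment> \<open>Back to a Gaussian law, for which adding the faded symbol is a translation
        of the kernel.\<close>
      also have "\<dots> = (\<integral>\<^sup>+ y. f (a, faded a w y) \<partial>PiM {1..n}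
          (\<lambda>k. complex_gaussian (interference_power s k)))"
        by (rule nn_integral_PiM_complex_gaussian[symmetric]) (auto simp: power_pos)
      also have "\<dots> = (\<integral>\<^sup>+ y. ennreal (?k w s y) * f (a, y) \<partial>L)"
        unfolding faded_def
        by (rule nn_integral_PiM_cgauss_shift[where f = "\<lambda>y. f (a, y)"]) (auto simp: power_pos)
      finally show ?thesis .
    qed
    then have "(\<integral>\<^sup>+ w. \<integral>\<^sup>+ s. \<integral>\<^sup>+ g. f (a, faded a w (scaled (interference_power s) g)) \<partial>W \<partial>XS \<partial>W) =
        (\<integral>\<^sup>+ w. \<integral>\<^sup>+ s. \<integral>\<^sup>+ y. ennreal (?k w s y) * f (a, y) \<partial>L \<partial>XS \<partial>W)"
      by (intro nn_integral_cong) auto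
    also have "\<dots> = (\<integral>\<^sup>+ s. \<integral>\<^sup>+ w. \<integral>\<^sup>+ y. ennreal (?k w s y) * f (a, y) \<partial>L \<partial>W \<partial>XS)"
      by (intro pair_sigma_finite.Fubini' pair_sigma_finite.intro XS.P.sigma_finite_measure_axioms
          W.sigma_finite_measure_axioms) measurable
    also have "\<dots> = (\<integral>\<^sup>+ s. \<integral>\<^sup>+ y. \<integral>\<^sup>+ w. ennreal (?k w s y) * f (a, y) \<partial>W \<partial>L \<partial>XS)"
      by (intro nn_integral_cong pair_sigma_finite.Fubini' pair_sigma_finite.intro
          L.sigma_finite_measure_axioms W.sigma_finite_measure_axioms) measurable
    also have "\<dots> = (\<integral>\<^sup>+ s. \<integral>\<^sup>+ y. (\<integral>\<^sup>+ w. ennreal (?k w s y) \<partial>W) * f (a, y) \<partial>L \<partial>XS)"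
      by (intro nn_integral_cong nn_integral_multc) measurable
    also have "\<dots> = (\<integral>\<^sup>+ s. \<integral>\<^sup>+ y. ennreal
        (cgauss_vec_density {1..n} (\<lambda>k. interference_power s k + (cmod (a k))\<^sup>2) y) * f (a, y) \<partial>L \<partial>XS)"
      by (simp add: nn_integral_cgauss_vec_convolution power_pos)
    finally show "(\<integral>\<^sup>+ w. \<integral>\<^sup>+ s. \<integral>\<^sup>+ g. f (a, faded a w (scaled (interference_power s) g)) \<partial>W \<partial>XS \<partial>W) =
      (\<integral>\<^sup>+ s. \<integral>\<^sup>+ y. ennreal (cgauss_vec_density {1..n}
          (\<lambda>k. interference_power s k + (cmod (a k))\<^sup>2) y) * f (a, y) \<partial>L \<partial>XS)" .
  qed
  also have "\<dots> = (\<integral>\<^sup>+ \<omega>. f (channel_input \<omega>, channel_output n \<omega>) \<partial>CH)"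
    by (rule nn_integral_joint[symmetric]) measurable
  finally show ?thesis .
qed

text \<open>This output shares \<open>s\<close> and \<open>g\<close> with the interference, but the
  log-density at it is integrated on its own, so its marginal law is all that counts.\<close>

lemma nn_integral_Omega_output:
  assumes f[measurable]: "f \<in> borel_measurable BS"
  shows "(\<integral>\<^sup>+ (a, w, s, g). f (scaled (received_power s) g) \<partial>Omega)
      = (\<integral>\<^sup>+ \<omega>. f (channel_output n \<omega>) \<partial>CH)"
proof -
  have "(\<integral>\<^sup>+ (a, w, s, g). f (scaled (received_power s) g) \<partial>Omega) =
    (\<integral>\<^sup>+ a. \<integral>\<^sup>+ w. \<integral>\<^sup>+ s. \<integral>\<^sup>+ g. f (scaled (received_power s) g) \<partial>W \<partial>XS \<partial>W \<partial>Q)"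
    by (subst nn_integral_Omega) (auto simp: case_prod_unfold)
  also have "\<dots> = (\<integral>\<^sup>+ s. \<integral>\<^sup>+ g. f (scaled (received_power s) g) \<partial>W \<partial>XS)"
    by (simp add: Q.emeasure_space_1 W.emeasure_space_1)
  also have "\<dots> = (\<integral>\<^sup>+ \<omega>. f (channel_output n \<omega>) \<partial>CH)"
    by (simp add: nn_integral_scaled power_pos nn_integral_output)
  finally show ?thesis .
qed

section \<open>Comparison of the powers and the pointwise information bound\<close>

lemma nn_integral_conditional_density:
  assumes [measurable]: "a \<in> space BS"
  shows "(\<integral>\<^sup>+ y. ennreal (conditional_density a y) \<partial>L) = 1"
proof -
  have "(\<integral>\<^sup>+ y. ennreal (conditional_density a y) \<partial>L) =
    (\<integral>\<^sup>+ s. \<integral>\<^sup>+ y. ennreal (cgauss_vec_density {1..n} (\<lambda>k. interference_power s k + (cmod (a k))\<^sup>2)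
        y) \<partial>L \<partial>XS)"
    unfolding nn_integral_conditional_mixture[symmetric]
    by (intro pair_sigma_finite.Fubini' pair_sigma_finite.intro L.sigma_finite_measure_axioms
        XS.P.sigma_finite_measure_axioms) measurable
  also have "\<dots> = 1"
    by (simp add: nn_integral_cgauss_vec_density total_power_pos XS.P.emeasure_space_1)
  finally show ?thesis .
qed

text \<open>The two series are compared term by term. The noise appears in both powers with
  coefficient 1, which is where \<open>1 \<le> M\<close> and \<open>m \<le> 1\<close> come
  in.\<close>

lemma received_interference_power:
  assumes M: "1 \<le> M" "\<And>l. \<alpha> l \<le> M * \<alpha> (Suc l)" and m: "0 \<le> m" "m \<le> 1" "\<And>l. m * \<alpha> (Suc l) \<le> \<alpha> l"
    and s: "finite_power s" and k: "k \<in> {1..n}"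
  shows "received_power s k \<le> M * interference_power s k"
    and "m * interference_power s k \<le> received_power s k"
proof -
  let ?f = "\<lambda>l. \<alpha> l * (cmod (s l k))\<^sup>2" and ?g = "\<lambda>l. \<alpha> (Suc l) * (cmod (s l k))\<^sup>2"
  have summ: "summable ?f" "summable ?g" using s k by (auto simp: finite_power_def)
  have "(\<Sum>l. ?f l) \<le> (\<Sum>l. M * ?g l)"
    using summ M(2) by (intro suminf_le summable_mult)
        (auto simp: mult.assoc[symmetric] intro: mult_right_mono)
  also have "\<dots> = M * (\<Sum>l. ?g l)" using summ by (intro suminf_mult) auto
  finally have "(\<Sum>l. ?f l) \<le> M * (\<Sum>l. ?g l)" .
  moreover have "\<sigma>2 \<le> M * \<sigma>2" using M(1) \<sigma>2_pos by simp
  ultimately show "received_power s k \<le> M * interference_power s k"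
    by (simp add: received_power_eq[of s k, OF summ(1)] interference_power_eq[of s k, OF summ(2)]
        distrib_left)
  have "(\<Sum>l. m * ?g l) \<le> (\<Sum>l. ?f l)"
    using summ m(3) by (intro suminf_le summable_mult)
        (auto simp: mult.assoc[symmetric] intro: mult_right_mono)
  moreover have "(\<Sum>l. m * ?g l) = m * (\<Sum>l. ?g l)" using summ by (intro suminf_mult) auto
  moreover have "m * \<sigma>2 \<le> \<sigma>2" using m \<sigma>2_pos by (simp add: mult_left_le_one_le)
  ultimately show "m * interference_power s k \<le> received_power s k"
    by (simp add: received_power_eq[of s k, OF summ(1)] interference_power_eq[of s k, OF summ(2)]
        distrib_left)
qed

text \<open>A Donsker--Varadhan ratio: the symbols follow a mismatched conditional law in the numerator
  and the true one in the denominator.  It has expectation 1, and the tilt by \<open>M\<close> is chosen so that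
  \<open>output_density\<close> is evaluated at a point which dominates an output of the channel in every
  coordinate.\<close>

definition likelihood_ratio :: "real \<Rightarrow> (nat \<Rightarrow> complex) \<Rightarrow> (nat \<Rightarrow> complex) \<Rightarrow> (nat \<Rightarrow> nat \<Rightarrow> complex) \<Rightarrow>
    (nat \<Rightarrow> complex) \<Rightarrow> real" where
  "likelihood_ratio M a w s y =
    conditional_density a (faded a w y) * cgauss_vec_density {1..n} (received_power s)
        (scaled (\<lambda>_. M) y) /
    (cgauss_vec_density {1..n} (interference_power s) y * output_density (scaled (\<lambda>_. M) y))"

lemma measurable_likelihood_ratio[measurable (raw)]:
  assumes [measurable]: "a \<in> measurable N Q" "w \<in> measurable N BS" "s \<in> measurable N XS"
      "y \<in> measurable N BS"
  shows "(\<lambda>\<omega>. likelihood_ratio M (a \<omega>) (w \<omega>) (s \<omega>) (y \<omega>)) \<in> borel_measurable N"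
proof -
  have [measurable]: "a \<in> measurable N BS" using assms(1)
      by (simp cong: measurable_cong_sets add: sets_Q)
  have [measurable]: "(\<lambda>\<omega>. faded (a \<omega>) (w \<omega>) (y \<omega>)) \<in> measurable N BS" by measurable
  have [measurable]: "(\<lambda>\<omega>. scaled (\<lambda>_. M) (y \<omega>)) \<in> measurable N BS" by measurable
  show ?thesis unfolding likelihood_ratio_def by measurable
qed

lemma likelihood_ratio_pos: "likelihood_ratio M a w s y > 0"
  unfolding likelihood_ratio_def
  by (intro divide_pos_pos mult_pos_pos conditional_density_pos output_density_pos
      cgauss_vec_density_pos power_pos)

text \<open>Fix \<open>a\<close> and \<open>w\<close>. The density of the interference given
  \<open>s\<close> cancels the kernel in the denominator; averaging the other kernel over
  \<open>s\<close> produces \<open>output_density\<close> at the same scaled point, which cancels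
  too, without any Jacobian. What remains is a translate of \<open>conditional_density a\<close>, of
  total mass 1.\<close>

lemma nn_integral_likelihood_ratio:
  "(\<integral>\<^sup>+ (a, w, s, g). ennreal (likelihood_ratio M a w s (scaled (interference_power s) g)) \<partial>Omega) = 1"
proof -
  have meas: "(\<lambda>(a, w, s, g). ennreal (likelihood_ratio M a w s (scaled (interference_power s) g)))
      \<in> borel_measurable Omega"
    unfolding case_prod_unfold by measurable
  have "(\<integral>\<^sup>+ (a, w, s, g). ennreal (likelihood_ratio M a w s (scaled (interference_power s) g)) \<partial>Omega) =
    (\<integral>\<^sup>+ a. \<integral>\<^sup>+ w. \<integral>\<^sup>+ s. \<integral>\<^sup>+ g. ennreal
        (likelihood_ratio M a w s (scaled (interference_power s) g)) \<partial>W \<partial>XS \<partial>W \<partial>Q)"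
    using nn_integral_Omega[OF meas] by simp
  also have "\<dots> = (\<integral>\<^sup>+ a. \<integral>\<^sup>+ w. 1 \<partial>W \<partial>Q)"
  proof (intro nn_integral_cong)
    fix a w assume a': "a \<in> space Q" and "w \<in> space W"
    then have a[measurable]: "a \<in> space BS" and w[measurable]: "w \<in> space BS"
      using sets_eq_imp_space_eq[OF sets_Q] sets_eq_imp_space_eq[OF sets_W] by simp_all
    let ?k = "\<lambda>s y. cgauss_vec_density {1..n} (received_power s) (scaled (\<lambda>_. M) y)"
    let ?r = "\<lambda>y. conditional_density a (faded a w y) / output_density (scaled (\<lambda>_. M) y)"
    have r_pos: "?r y > 0" for y
      using conditional_density_pos output_density_pos by simp
    have [measurable]: "(\<lambda>y. faded a w y) \<in> measurable BS BS" "(\<lambda>y. scaled (\<lambda>_. M) y) \<in> measurable BS BS"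
      by measurable
    have [measurable]: "(\<lambda>y. conditional_density a (faded a w y)) \<in> borel_measurable BS"
      using a' by measurable
    have "(\<integral>\<^sup>+ g. ennreal (likelihood_ratio M a w s (scaled (interference_power s) g)) \<partial>W) =
        (\<integral>\<^sup>+ y. ennreal (?r y) * ennreal (?k s y) \<partial>L)" if [measurable]: "s \<in> space XS" for s
    proof -
      have "(\<integral>\<^sup>+ g. ennreal (likelihood_ratio M a w s (scaled (interference_power s) g)) \<partial>W) =
        (\<integral>\<^sup>+ y. ennreal (cgauss_vec_density {1..n} (interference_power s) y) * ennreal
            (likelihood_ratio M a w s y) \<partial>L)"
        using a' by (intro nn_integral_scaled[OF power_pos(2),
            where f = "\<lambda>y. ennreal (likelihood_ratio M a w s y)"]) measurable
      also have "\<dots> = (\<integral>\<^sup>+ y. ennreal (?r y) * ennreal (?k s y) \<partial>L)"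
      proof (rule nn_integral_cong)
        fix y
        have kp: "cgauss_vec_density {1..n} (interference_power s) y > 0" "?k s y > 0"
          by (intro cgauss_vec_density_pos power_pos)+
        then show "ennreal (cgauss_vec_density {1..n} (interference_power s) y) * ennreal
            (likelihood_ratio M a w s y) =
            ennreal (?r y) * ennreal (?k s y)"
          using likelihood_ratio_pos[of M a w s y] r_pos[of y]
          by (simp add: ennreal_mult[symmetric] likelihood_ratio_def less_imp_le)
      qed
      finally show ?thesis .
    qed
    then have "(\<integral>\<^sup>+ s. \<integral>\<^sup>+ g. ennreal (likelihood_ratio M a w s (scaled (interference_power s) g))
        \<partial>W \<partial>XS) =
       (\<integral>\<^sup>+ s. \<integral>\<^sup>+ y. ennreal (?r y) * ennreal (?k s y) \<partial>L \<partial>XS)"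
      by (intro nn_integral_cong) auto
    also have "\<dots> = (\<integral>\<^sup>+ y. \<integral>\<^sup>+ s. ennreal (?r y) * ennreal (?k s y) \<partial>XS \<partial>L)"
      by (intro pair_sigma_finite.Fubini' pair_sigma_finite.intro XS.P.sigma_finite_measure_axioms
          L.sigma_finite_measure_axioms) measurable
    also have "\<dots> = (\<integral>\<^sup>+ y. ennreal (?r y) * (\<integral>\<^sup>+ s. ennreal (?k s y) \<partial>XS) \<partial>L)"
      by (intro nn_integral_cong nn_integral_cmult) measurable
    also have "\<dots> = (\<integral>\<^sup>+ y. ennreal (conditional_density a (faded a w y)) \<partial>L)"
      unfolding nn_integral_output_mixture
    proof (rule nn_integral_cong)
      fix y
      show "ennreal (?r y) * ennreal (output_density (scaled (\<lambda>_. M) y)) = ennreal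
          (conditional_density a (faded a w y))"
        using r_pos[of y] output_density_pos[of "scaled (\<lambda>_. M) y"]
            by (simp add: ennreal_mult[symmetric] less_imp_le)
    qed
    also have "\<dots> = (\<integral>\<^sup>+ y. ennreal (conditional_density a y) \<partial>L)"
      unfolding faded_def using a'
      by (intro nn_integral_PiM_lborel_shift[where f = "\<lambda>y. ennreal (conditional_density a y)"])
          measurable
    also have "\<dots> = 1" by (rule nn_integral_conditional_density[OF a])
    finally show "(\<integral>\<^sup>+ s. \<integral>\<^sup>+ g. ennreal
        (likelihood_ratio M a w s (scaled (interference_power s) g)) \<partial>W \<partial>XS) = 1" .
  qed
  also have "\<dots> = 1" by (simp add: Q.emeasure_space_1 W.emeasure_space_1)
  finally show ?thesis .
qed

lemma cgauss_vec_density_antimono: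
  assumes "\<And>k. k \<in> {1..n} \<Longrightarrow> v k > 0" "\<And>k. k \<in> {1..n} \<Longrightarrow> cmod (y' k) \<le> cmod (y k)"
  shows "cgauss_vec_density {1..n} v y \<le> cgauss_vec_density {1..n} v y'"
  unfolding cgauss_vec_density_def
  using assms by (intro prod_mono conjI cgauss_density_nonneg)
    (auto simp: cgauss_density_def less_imp_le intro!: divide_right_mono power_mono)

text \<open>Every component of the mixture is a centred Gaussian and decreases in each
  modulus.\<close>

lemma output_density_antimono:
  assumes "\<And>k. k \<in> {1..n} \<Longrightarrow> cmod (y' k) \<le> cmod (y k)"
  shows "output_density y \<le> output_density y'"
  unfolding output_density_def
  using assms power_pos(1) power_ge_\<sigma>2(1)
  by (intro integral_mono integrable_cgauss_mixture integrable_power cgauss_vec_density_antimono) auto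

text \<open>The inequality ln t <= t - 1 is used here pointwise on the coupling: the summand after
  \<open>real n * ln M\<close> compares quadratic forms, and the last one replaces the scaled
  interference by a true output driven by the same \<open>g\<close>.\<close>

lemma ln_conditional_density_bound:
  assumes M: "1 \<le> M" "\<And>l. \<alpha> l \<le> M * \<alpha> (Suc l)" and m: "0 < m" "m \<le> 1" "\<And>l. m * \<alpha> (Suc l) \<le> \<alpha> l"
    and s: "finite_power s"
  shows "ln (conditional_density a (faded a w (scaled (interference_power s) g))) \<le>
    likelihood_ratio M a w s (scaled (interference_power s) g) - 1 + real n * ln M
    + (M / m - 1) * (\<Sum>k=1..n. (cmod (g k))\<^sup>2) + ln (output_density (scaled (received_power s) g))"
proof -
  let ?y = "scaled (interference_power s) g"
  let ?F = "output_density (scaled (\<lambda>_. M) ?y)"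
  let ?A = "cgauss_vec_density {1..n} (received_power s) (scaled (\<lambda>_. M) ?y)"
  let ?B = "cgauss_vec_density {1..n} (interference_power s) ?y"
  note power = received_interference_power[OF M less_imp_le[OF m(1)] m(2,3) s]
  have pos: "?A > 0" "?B > 0" by (intro cgauss_vec_density_pos power_pos)+
  have "ln (conditional_density a (faded a w ?y)) + ln ?A - ln ?B - ln ?F = ln
      (likelihood_ratio M a w s ?y)"
    using pos conditional_density_pos output_density_pos unfolding likelihood_ratio_def
    by (simp add: ln_mult ln_div less_imp_neq[symmetric])
  also have "\<dots> \<le> likelihood_ratio M a w s ?y - 1"
    by (rule ln_le_minus_one[OF likelihood_ratio_pos])
  finally have 1: "ln (conditional_density a (faded a w ?y)) \<le> likelihood_ratio M a w s ?y - 1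
      + (ln ?B - ln ?A) + ln ?F" by simp
  \<comment> \<open>In each coordinate the normalising factors differ by at most ln M, by the upper
    bound on the received power. The quadratic forms are |g|^2 and M times the power ratio times
    |g|^2, where the lower bound limits the coefficient to M / m.\<close>
  have "ln ?B - ln ?A \<le> (\<Sum>k=1..n. ln M + (M / m - 1) * (cmod (g k))\<^sup>2)"
    unfolding ln_cgauss_vec_density[OF power_pos(1)] ln_cgauss_vec_density[OF power_pos(2)]
        sum_subtractf[symmetric]
  proof (rule sum_mono)
    fix k assume k: "k \<in> {1..n}"
    let ?R = "received_power s k" and ?I = "interference_power s k"
    have p: "?R > 0" "?I > 0" by (rule power_pos)+
    have y: "(cmod (?y k))\<^sup>2 / ?I = (cmod (g k))\<^sup>2"
      using k p by (simp add: scaled_def norm_mult power_mult_distrib)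
    have y': "(cmod (scaled (\<lambda>_. M) ?y k))\<^sup>2 / ?R = M * ?I / ?R * (cmod (g k))\<^sup>2"
      using k p M(1) by (simp add: scaled_def norm_mult power_mult_distrib)
    have "ln (pi * ?R) \<le> ln (M * (pi * ?I))"
      using p M(1) power(1)[OF k] by (simp add: mult.left_commute)
    also have "\<dots> = ln M + ln (pi * ?I)" using p M(1) by (subst ln_mult) auto
    finally have "ln (pi * ?R) - ln (pi * ?I) \<le> ln M" by simp
    moreover have "M * ?I / ?R * (cmod (g k))\<^sup>2 \<le> M / m * (cmod (g k))\<^sup>2"
    proof (rule mult_right_mono)
      have "M * (m * ?I) \<le> M * ?R" using power(2)[OF k] M(1) by (intro mult_left_mono) auto
      then show "M * ?I / ?R \<le> M / m" using p m(1) by (simp add: field_simps)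
    qed simp
    ultimately show "- ((cmod (?y k))\<^sup>2 / ?I) - ln (pi * ?I)
        - (- ((cmod (scaled (\<lambda>_. M) ?y k))\<^sup>2 / ?R) - ln (pi * ?R)) \<le>
        ln M + (M / m - 1) * (cmod (g k))\<^sup>2"
      unfolding y y' by (simp add: left_diff_distrib)
  qed
  also have "\<dots> = real n * ln M + (M / m - 1) * (\<Sum>k=1..n. (cmod (g k))\<^sup>2)"
    by (simp add: sum.distrib sum_distrib_left)
  finally have 2: "ln ?B - ln ?A \<le> real n * ln M + (M / m - 1) * (\<Sum>k=1..n. (cmod (g k))\<^sup>2)" .
  \<comment> \<open>Both points are multiples of the same \<open>g k\<close>, so the power
    comparison becomes a comparison of moduli.\<close>
  have "?F \<le> output_density (scaled (received_power s) g)"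
  proof (rule output_density_antimono)
    fix k assume k: "k \<in> {1..n}"
    have "sqrt (received_power s k) \<le> sqrt M * sqrt (interference_power s k)"
      using power(1)[OF k] by (simp add: real_sqrt_mult[symmetric])
    then have "sqrt (received_power s k) * cmod (g k) \<le> sqrt M * sqrt (interference_power s k)
        * cmod (g k)"
      by (rule mult_right_mono) simp
    then show "cmod (scaled (received_power s) g k) \<le> cmod (scaled (\<lambda>_. M) ?y k)"
      using k M(1) power_pos by (simp add: scaled_def norm_mult less_imp_le mult.assoc)
  qed
  then have "ln ?F \<le> ln (output_density (scaled (received_power s) g))"
    using output_density_pos by simp
  with 1 2 show ?thesis by linarith
qed

section \<open>Expectations over the coupling\<close>

lemma integral_Omega_joint:
  "integrable Omega (\<lambda>(a, w, s, g). ln (conditional_density a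
      (faded a w (scaled (interference_power s) g))))"
  "(\<integral>(a, w, s, g). ln (conditional_density a (faded a w (scaled (interference_power s) g))) \<partial>Omega) =
    (\<integral>\<omega>. ln (conditional_density (channel_input \<omega>) (channel_output n \<omega>)) \<partial>CH)"
proof -
  note measurable_channel_input_Q[measurable]
  let ?f = "\<lambda>(a, w, s, g). (a, faded a w (scaled (interference_power s) g))"
  let ?f' = "\<lambda>\<omega>. (channel_input \<omega>, channel_output n \<omega>)"
  let ?h = "\<lambda>(a, y). ln (conditional_density a y)"
  have f: "?f \<in> measurable Omega (BS \<Otimes>\<^sub>M BS)"
    unfolding case_prod_unfold by measurable
  have f': "?f' \<in> measurable CH (BS \<Otimes>\<^sub>M BS)" by measurable
  have eq: "distr Omega (BS \<Otimes>\<^sub>M BS) ?f = distr CH (BS \<Otimes>\<^sub>M BS) ?f'"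
  proof (rule measure_eqI)
    fix A assume "A \<in> sets (distr Omega (BS \<Otimes>\<^sub>M BS) ?f)"
    then have A[measurable]: "A \<in> sets (BS \<Otimes>\<^sub>M BS)" by simp
    have "emeasure (distr Omega (BS \<Otimes>\<^sub>M BS) ?f) A = (\<integral>\<^sup>+ p. indicator A p \<partial>distr Omega (BS \<Otimes>\<^sub>M BS) ?f)"
      by simp
    also have "\<dots> = (\<integral>\<^sup>+ \<omega>. indicator A (?f \<omega>) \<partial>Omega)"
      by (rule nn_integral_distr[OF f]) measurable
    also have "\<dots> = (\<integral>\<^sup>+ \<omega>. indicator A (?f' \<omega>) \<partial>CH)"
      using nn_integral_Omega_joint[of "indicator A"] by (simp add: case_prod_unfold)
    also have "\<dots> = (\<integral>\<^sup>+ p. indicator A p \<partial>distr CH (BS \<Otimes>\<^sub>M BS) ?f')"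
      by (rule nn_integral_distr[OF f', symmetric]) measurable
    also have "\<dots> = emeasure (distr CH (BS \<Otimes>\<^sub>M BS) ?f') A" by simp
    finally show "emeasure (distr Omega (BS \<Otimes>\<^sub>M BS) ?f) A = emeasure (distr CH (BS \<Otimes>\<^sub>M BS) ?f') A" .
  qed simp
  have h: "?h \<in> borel_measurable (BS \<Otimes>\<^sub>M BS)"
  proof -
    have "?h \<in> borel_measurable (Q \<Otimes>\<^sub>M BS)" unfolding case_prod_unfold by measurable
    then show ?thesis
      by (simp cong: measurable_cong_sets sets_pair_measure_cong add: sets_Q)
  qed
  have int: "integrable (distr CH (BS \<Otimes>\<^sub>M BS) ?f') ?h"
    unfolding integrable_distr_eq[OF f' h] using integrable_ln_conditional_density by simp
  from int[folded eq, unfolded integrable_distr_eq[OF f h]]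
  show "integrable Omega (\<lambda>(a, w, s, g). ln
      (conditional_density a (faded a w (scaled (interference_power s) g))))"
    by (simp add: case_prod_unfold)
  show "(\<integral>(a, w, s, g). ln (conditional_density a (faded a w (scaled (interference_power s) g)))
      \<partial>Omega) =
    (\<integral>\<omega>. ln (conditional_density (channel_input \<omega>) (channel_output n \<omega>)) \<partial>CH)"
    using integral_distr[OF f h] integral_distr[OF f' h] unfolding eq by (simp add: case_prod_unfold)
qed

lemma integral_Omega_output:
  "integrable Omega (\<lambda>(a, w, s, g). ln (output_density (scaled (received_power s) g)))"
  "(\<integral>(a, w, s, g). ln (output_density (scaled (received_power s) g)) \<partial>Omega) =
    (\<integral>\<omega>. ln (output_density (channel_output n \<omega>)) \<partial>CH)"
proof -
  let ?f = "\<lambda>(a, w, s, g). scaled (received_power s) g"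
  let ?h = "\<lambda>y. ln (output_density y)"
  have f: "?f \<in> measurable Omega BS"
    unfolding case_prod_unfold by measurable
  have f': "channel_output n \<in> measurable CH BS" by measurable
  have eq: "distr Omega BS ?f = distr CH BS (channel_output n)"
  proof (rule measure_eqI)
    fix A assume "A \<in> sets (distr Omega BS ?f)"
    then have A[measurable]: "A \<in> sets BS" by simp
    have "emeasure (distr Omega BS ?f) A = (\<integral>\<^sup>+ p. indicator A p \<partial>distr Omega BS ?f)"
      by simp
    also have "\<dots> = (\<integral>\<^sup>+ \<omega>. indicator A (?f \<omega>) \<partial>Omega)"
      by (rule nn_integral_distr[OF f]) measurable
    also have "\<dots> = (\<integral>\<^sup>+ \<omega>. indicator A (channel_output n \<omega>) \<partial>CH)"
      using nn_integral_Omega_output[of "indicator A"] by (simp add: case_prod_unfold)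
    also have "\<dots> = (\<integral>\<^sup>+ p. indicator A p \<partial>distr CH BS (channel_output n))"
      by (rule nn_integral_distr[OF f', symmetric]) measurable
    also have "\<dots> = emeasure (distr CH BS (channel_output n)) A" by simp
    finally show "emeasure (distr Omega BS ?f) A = emeasure (distr CH BS (channel_output n)) A" .
  qed simp
  have h: "?h \<in> borel_measurable BS" by measurable
  have int: "integrable (distr CH BS (channel_output n)) ?h"
    unfolding integrable_distr_eq[OF f' h] by (rule integrable_ln_output_density)
  from int[folded eq, unfolded integrable_distr_eq[OF f h]]
  show "integrable Omega (\<lambda>(a, w, s, g). ln (output_density (scaled (received_power s) g)))"
    by (simp add: case_prod_unfold)
  show "(\<integral>(a, w, s, g). ln (output_density (scaled (received_power s) g)) \<partial>Omega) =
    (\<integral>\<omega>. ln (output_density (channel_output n \<omega>)) \<partial>CH)"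
    using integral_distr[OF f h] integral_distr[OF f' h] unfolding eq by (simp add: case_prod_unfold)
qed

lemma integral_Omega_energy:
  assumes k: "k \<in> {1..n}"
  shows "integrable Omega (\<lambda>(a, w, s, g). (cmod (g k))\<^sup>2)"
    and "(\<integral>(a, w, s, g). (cmod (g k))\<^sup>2 \<partial>Omega) = 1"
proof -
  have meas: "(\<lambda>(a, w, s, g). (cmod (g k))\<^sup>2) \<in> borel_measurable Omega"
    unfolding case_prod_unfold using k by measurable
  have "(\<integral>\<^sup>+ (a, w, s, g). ennreal ((cmod (g k))\<^sup>2) \<partial>Omega) = (\<integral>\<^sup>+ g. ennreal ((cmod (g k))\<^sup>2) \<partial>W)"
    using k by (subst nn_integral_Omega)
      (auto simp: case_prod_unfold Q.emeasure_space_1 W.emeasure_space_1 XS.P.emeasure_space_1)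
  also have "\<dots> = (\<integral>\<^sup>+ y. ennreal (cgauss_vec_density {1..n} (\<lambda>_. 1) y) * ennreal ((cmod (y k))\<^sup>2) \<partial>L)"
    using k by (intro nn_integral_PiM_complex_gaussian) auto
  also have "\<dots> = 1"
    using k by (subst cgauss_vec_second_moment) auto
  finally have nn: "(\<integral>\<^sup>+ (a, w, s, g). ennreal ((cmod (g k))\<^sup>2) \<partial>Omega) = 1" .
  then have "has_bochner_integral Omega (\<lambda>(a, w, s, g). (cmod (g k))\<^sup>2) 1"
    using meas by (intro has_bochner_integral_nn_integral) (auto simp: case_prod_unfold)
  then show "integrable Omega (\<lambda>(a, w, s, g). (cmod (g k))\<^sup>2)"
      "(\<integral>(a, w, s, g). (cmod (g k))\<^sup>2 \<partial>Omega) = 1"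
    by (auto simp: has_bochner_integral_iff)
qed

text \<open>On taking expectations in the pointwise bound, the likelihood ratio has mean 1 and
  cancels the - 1, the energy of \<open>g\<close> has mean \<open>n\<close>, and the remaining
  output term is the one subtracted in the mutual information.\<close>

lemma mutual_information_le:
  assumes M: "1 \<le> M" "\<And>l. \<alpha> l \<le> M * \<alpha> (Suc l)" and m: "0 < m" "m \<le> 1" "\<And>l. m * \<alpha> (Suc l) \<le> \<alpha> l"
  shows "mutual_information_nats CH BS BS channel_input (channel_output n) \<le> ereal
      (real n * (ln M + (M / m - 1)))"
proof -
  let ?lr = "\<lambda>(a, w, s, g). likelihood_ratio M a w s (scaled (interference_power s) g)"
  let ?E = "\<lambda>(a, w, s, g). (\<Sum>k=1..n. (cmod (g k))\<^sup>2)"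
  let ?cd = "\<lambda>(a, w, s, g). ln (conditional_density a (faded a w (scaled (interference_power s) g)))"
  let ?f = "\<lambda>(a, w, s, g). ln (output_density (scaled (received_power s) g))"
  have lr_meas: "?lr \<in> borel_measurable Omega"
    unfolding case_prod_unfold by measurable
  have lr: "has_bochner_integral Omega ?lr 1"
    using lr_meas nn_integral_likelihood_ratio[of M] likelihood_ratio_pos
    by (intro has_bochner_integral_nn_integral) (auto simp: case_prod_unfold less_imp_le)
  have E: "has_bochner_integral Omega ?E (\<Sum>k=1..n. 1)"
    using integral_Omega_energy
    by (auto simp: case_prod_unfold has_bochner_integral_iff intro!: has_bochner_integral_sum)
  have f: "has_bochner_integral Omega ?f (\<integral>\<omega>. ln (output_density (channel_output n \<omega>)) \<partial>CH)"
    using integral_Omega_output by (auto simp: has_bochner_integral_iff)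
  let ?rhs = "\<lambda>\<omega>. ?lr \<omega> + (- 1 + real n * ln M) + (M / m - 1) * ?E \<omega> + ?f \<omega>"
  have const: "has_bochner_integral Omega (\<lambda>_. - 1 + real n * ln M) (- 1 + real n * ln M)"
    by (simp add: has_bochner_integral_iff Omega.P.prob_space)
  have rhs: "has_bochner_integral Omega ?rhs
      (1 + (- 1 + real n * ln M) + (M / m - 1) * (\<Sum>k=1..n. 1)
      + (\<integral>\<omega>. ln (output_density (channel_output n \<omega>)) \<partial>CH))"
    by (intro has_bochner_integral_add has_bochner_integral_mult_right lr const E f)
  \<comment> \<open>The exceptional block sequences lie in a null set \<open>N\<close> of
    \<open>XS\<close>; its preimage is null because the third component of \<open>Omega\<close> has
    law \<open>XS\<close>.\<close>
  have AE_s: "AE \<omega> in Omega. finite_power (fst (snd (snd \<omega>)))"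
  proof -
    obtain N where N: "N \<in> null_sets XS" "{s \<in> space XS. \<not> finite_power s} \<subseteq> N"
      using AE_finite_power unfolding eventually_ae_filter by auto
    then have [measurable]: "N \<in> sets XS" by auto
    have "(\<integral>\<^sup>+ \<omega>. indicator N (fst (snd (snd \<omega>))) \<partial>Omega) = (\<integral>\<^sup>+ s. indicator N s \<partial>XS)"
      by (subst nn_integral_Omega) (auto simp: Q.emeasure_space_1 W.emeasure_space_1)
    also have "\<dots> = 0" using N by (auto simp: null_sets_def)
    finally have "AE \<omega> in Omega. (indicator N (fst (snd (snd \<omega>))) :: ennreal) = 0"
      by (subst (asm) nn_integral_0_iff_AE) auto
    then show ?thesis
      using AE_space
      by eventually_elim (use N(2) in \<open>auto simp: space_pair_measure indicator_def split: if_splits\<close>)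
  qed
  have "(\<integral>\<omega>. ?cd \<omega> \<partial>Omega) \<le> (\<integral>\<omega>. ?rhs \<omega> \<partial>Omega)"
  proof (rule integral_mono_AE)
    show "integrable Omega ?cd" by (rule integral_Omega_joint)
    show "integrable Omega ?rhs" using rhs by (simp only: has_bochner_integral_iff)
    show "AE \<omega> in Omega. ?cd \<omega> \<le> ?rhs \<omega>"
      using AE_s
    proof eventually_elim
      case (elim \<omega>)
      show ?case
        using ln_conditional_density_bound[OF M m elim, of "fst \<omega>" "fst (snd \<omega>)" "snd (snd (snd \<omega>))"]
        by (simp add: case_prod_unfold)
    qed
  qed
  also have "\<dots> = real n * ln M + (M / m - 1) * real n
      + (\<integral>\<omega>. ln (output_density (channel_output n \<omega>)) \<partial>CH)"
    using has_bochner_integral_integral_eq[OF rhs] by simp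
  finally show ?thesis
    unfolding mutual_information_eq integral_Omega_joint by (simp add: algebra_simps)
qed

end

section \<open>The capacity bound\<close>

text \<open>The test input is a single symbol equal to sqrt P, which meets the power constraint with
  equality. With constant symbols, finiteness of the received power says that P times the series of
  fading variances converges.\<close>

lemma interference_converges_imp_summable:
  assumes \<alpha>: "\<And>l. \<alpha> l > 0" and "P > 0" "\<sigma>2 > 0" and conv: "interference_converges \<alpha> P \<sigma>2"
  shows "summable \<alpha>"
proof -
  define Q where "Q = return (block_space 1) (\<lambda>k\<in>{1::nat}. complex_of_real (sqrt P))"
  have x_space: "(\<lambda>k\<in>{1::nat}. complex_of_real (sqrt P)) \<in> space (block_space 1)"
    by (simp add: space_PiM)
  interpret Q: prob_space Q
    unfolding Q_def by (rule prob_space_return[OF x_space])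
  have sets_Q: "sets Q = sets (block_space 1)" by (simp add: Q_def)
  have "(\<integral>\<^sup>+ x. ennreal (1 / real 1 * (\<Sum>k=1..1. (cmod (x k))\<^sup>2)) \<partial>Q) \<le> ennreal P"
    unfolding Q_def using \<open>P > 0\<close> x_space by (subst nn_integral_return) auto
  then have "Q \<in> admissible_inputs P 1"
    unfolding admissible_inputs_def using Q.prob_space_axioms sets_Q by simp
  then have "AE \<omega> in channel_space \<alpha> \<sigma>2 1 Q. summable (interference_term 1 \<omega>)"
    using conv unfolding interference_converges_def by (auto dest!: spec[of _ 1] bspec)
  then have 1: "AE x in PiM UNIV (\<lambda>_. Q). AE g in PiM UNIV (\<lambda>l. complex_gaussian (\<alpha> l)).
      (\<lambda>N. \<Sum>l<N. g l * x l 1) \<longlonglongrightarrow> g 0 * x 0 1 + (\<Sum>l. g (Suc l) * x (Suc l) 1)"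
    by (intro AE_output_series_converges[OF \<alpha> \<open>\<sigma>2 > 0\<close> Q.prob_space_axioms sets_Q]) auto
  have "AE a in Q. a 1 = complex_of_real (sqrt P)"
    unfolding Q_def using x_space by (subst AE_return) auto
  then have 2: "AE x in PiM UNIV (\<lambda>_::nat. Q). \<forall>l. x l 1 = complex_of_real (sqrt P)"
    unfolding AE_all_countable by (intro allI AE_PiM_component Q.prob_space_axioms) auto
  interpret X: prob_space "PiM UNIV (\<lambda>_::nat. Q)" by (intro prob_space_PiM Q.prob_space_axioms)
  from 1 2 have "AE x in PiM UNIV (\<lambda>_. Q). (AE g in PiM UNIV (\<lambda>l. complex_gaussian (\<alpha> l)).
      (\<lambda>N. \<Sum>l<N. g l * x l 1) \<longlonglongrightarrow> g 0 * x 0 1 + (\<Sum>l. g (Suc l) * x (Suc l) 1)) \<and>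
      (\<forall>l. x l 1 = complex_of_real (sqrt P))" by (rule AE_conjI)
  from eventually_happens'[OF X.ae_filter_bot this]
  obtain x :: "nat \<Rightarrow> nat \<Rightarrow> complex" where "AE g in PiM UNIV (\<lambda>l. complex_gaussian (\<alpha> l)).
      (\<lambda>N. \<Sum>l<N. g l * x l 1) \<longlonglongrightarrow> g 0 * x 0 1 + (\<Sum>l. g (Suc l) * x (Suc l) 1)"
      and x: "\<And>l. x l 1 = complex_of_real (sqrt P)" by blast
  then have "summable (\<lambda>l. \<alpha> l * (cmod (x l 1))\<^sup>2)"
    by (intro nn_integral_cgauss_infinite_sum(1)[OF \<alpha> \<open>\<sigma>2 > 0\<close>
        measurable_weighted_series[where c = "\<lambda>l. x l 1"]])
  then show ?thesis
    using \<open>P > 0\<close> summable_mult2[of "\<lambda>l. \<alpha> l * P" "1 / P"]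
    by (simp add: x del: One_nat_def)
qed

theorem proposition1:
  fixes \<rho> P \<sigma>2 \<eta>min2 \<eta>max2 :: real and \<alpha> :: "nat \<Rightarrow> real"
  assumes "0 < \<rho>" and "\<rho> < 1"
    and "\<alpha> 0 = 1"
    and "\<And>l. l \<ge> 1 \<Longrightarrow> \<alpha> l > 0"
    and "\<And>l. l \<ge> 1 \<Longrightarrow> \<alpha> l \<ge> \<alpha> (l + 1)"
    and "\<And>l. l \<ge> 1 \<Longrightarrow> \<alpha> (l + 1) / \<alpha> l \<ge> \<rho>"
    and "P > 0" and "\<sigma>2 > 0"
    and "interference_converges \<alpha> P \<sigma>2"
    and "\<eta>min2 = min 1 (\<alpha> 0 / \<alpha> 1)"
    and "\<eta>max2 = max (\<alpha> 0 / \<alpha> 1) (1 / \<rho>)"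
  shows "capacity \<alpha> P \<sigma>2 \<le>
    ereal (ln (pi / 2) + 2 * (\<eta>max2 / \<eta>min2 - 1 / 2) + ln \<eta>max2 + 1 / 2 * ln (\<eta>max2 / \<eta>min2))"
proof -
  have \<alpha>: "\<alpha> l > 0" for l
    using assms(3) assms(4)[of l] by (cases l) auto
  have max1: "1 \<le> \<eta>max2" and min: "0 < \<eta>min2" "\<eta>min2 \<le> 1"
    using assms(1-3,10,11) \<alpha>[of 1] by (auto simp: le_max_iff_disj)
  \<comment> \<open>At index 0 the ratio is the first entry of the maximum; from index 1 on the
    assumption on \<rho> bounds it by the second.\<close>
  have ratio_max: "\<alpha> l \<le> \<eta>max2 * \<alpha> (Suc l)" for l
  proof (cases "l = 0")
    case True
    have "1 / \<alpha> 1 \<le> \<eta>max2" using assms(3,11) by simp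
    then show ?thesis using True assms(3) \<alpha>[of 1] by (simp add: pos_divide_le_eq)
  next
    case False
    have "\<rho> * \<alpha> l \<le> \<alpha> (Suc l)"
      using assms(6)[of l] False \<alpha>[of l] by (simp add: pos_le_divide_eq)
    then have "\<alpha> l \<le> 1 / \<rho> * \<alpha> (Suc l)"
      using assms(1) by (simp add: pos_le_divide_eq mult.commute)
    also have "\<dots> \<le> \<eta>max2 * \<alpha> (Suc l)"
      using assms(11) \<alpha>[of "Suc l"] by (intro mult_right_mono) auto
    finally show ?thesis .
  qed
  \<comment> \<open>At index 0 the second entry of the minimum applies; later the variances decrease
    and the entry 1 suffices.\<close>
  have ratio_min: "\<eta>min2 * \<alpha> (Suc l) \<le> \<alpha> l" for l
  proof (cases "l = 0")
    case True
    have "\<eta>min2 \<le> 1 / \<alpha> 1" using assms(3,10) by simp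
    then show ?thesis using True assms(3) \<alpha>[of 1] by (simp add: pos_le_divide_eq)
  next
    case False
    have "\<eta>min2 * \<alpha> (Suc l) \<le> 1 * \<alpha> (Suc l)"
      using min \<alpha>[of "Suc l"] by (intro mult_right_mono) auto
    then show ?thesis using assms(5)[of l] False by simp
  qed
  have summable: "summable \<alpha>"
    by (rule interference_converges_imp_summable[OF \<alpha> assms(7-9)])
  define B where "B = ln \<eta>max2 + (\<eta>max2 / \<eta>min2 - 1)"
  have "capacity \<alpha> P \<sigma>2 \<le> ereal B"
    unfolding capacity_def
  proof (rule Limsup_bounded, rule eventually_mono[OF eventually_gt_at_top[of 0]])
    fix n :: nat assume n: "0 < n"
    have "mutual_information_nats (channel_space \<alpha> \<sigma>2 n Q) (block_space n) (block_space n)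
        channel_input (channel_output n)
        \<le> ereal (real n * B)" if "Q \<in> admissible_inputs P n" for Q
    proof -
      interpret channel_block \<alpha> \<sigma>2 P n Q
        using assms(3,8,9) \<alpha> summable that
        by unfold_locales (auto simp: interference_converges_def)
      show ?thesis unfolding B_def by (rule mutual_information_le[OF max1 ratio_max min ratio_min])
    qed
    then have "ereal (1 / real n) * (SUP Q \<in> admissible_inputs P n.
         mutual_information_nats (channel_space \<alpha> \<sigma>2 n Q) (block_space n) (block_space n)
           channel_input (channel_output n)) \<le> ereal (1 / real n) * ereal (real n * B)"
      using n by (intro ereal_mult_left_mono SUP_least) auto
    also have "\<dots> = ereal B" using n by simp
    finally show "ereal (1 / real n) * (SUP Q \<in> admissible_inputs P n.
         mutual_information_nats (channel_space \<alpha> \<sigma>2 n Q) (block_space n) (block_space n)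
           channel_input (channel_output n)) \<le> ereal B" .
  qed
  also have "B \<le> ln (pi / 2) + 2 * (\<eta>max2 / \<eta>min2 - 1 / 2) + ln \<eta>max2 + 1 / 2 * ln (\<eta>max2 / \<eta>min2)"
  proof -
    \<comment> \<open>The claimed bound exceeds \<open>B\<close> by ln (pi / 2) + r + (ln r) / 2,
      and all three terms are nonnegative because r >= 1.\<close>
    define r where "r = \<eta>max2 / \<eta>min2"
    have "1 \<le> r" using max1 min by (simp add: r_def pos_le_divide_eq)
    moreover have "0 \<le> ln r" using \<open>1 \<le> r\<close> by (rule ln_ge_zero)
    moreover have "0 \<le> ln (pi / 2)" using pi_ge_two by (intro ln_ge_zero) simp
    ultimately show ?thesis unfolding B_def r_def[symmetric] by (simp add: algebra_simps)
  qed
  finally show ?thesis by simp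
qed

end
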